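(* The standard monomials in $x(A,B)$, $y(I)$, $z(J)$, $x(\mathbf 1)$, $x(\mathbf 0)$ (with $(A,B)\in H_p$, $I\in H_u$, $J\in H_\xi$) form a basis of the $K$-vector space $R(D)$.
   Context: Let $K$ be an algebraically closed field of arbitrary characteristic, $V=K^n$, $m,q>n$, $X=V^{\oplus m}\oplus(V^* )^{\oplus q}$, with points $(u_1,\dots,u_m,\xi_1,\dots,\xi_q)$, $\langle u_i,\xi_j\rangle=\xi_j(u_i)$. Fixing a basis of $V$, $X$ is identified with $M_{m,n}(K)\times M_{n,q}(K)$, a point being $(U,W)$ with $u_i$ the $i$-th row of $U$ and $\xi_j$ the $j$-th column of $W$. $I(r,k)$ is the set of strictly increasing $r$-tuples of elements of $\{1,\dots,k\}$. For $A\in I(r,k)$, $A'\in I(r',k)$ write $A\ge A'$ if $r\le r'$ and $a_j\ge a'_j$ for $1\le j\le r$. $H_u=I(n,m)$, $H_\xi=I(n,q)$ (regarded as disjoint), $H_p=\bigcup_{1\le r\le n}I(r,m)\times I(r,q)$, $H=H_u\,\dot\cup\,H_\xi\,\dot\cup\,H_p$. Partial order on $H$: on $H_u,H_\xi$ the componentwise order, i.e. $(i_1,\dots,i_n)\ge(i'_1,\dots,i'_n)$ iff $i_j\ge i'_j$ for $1\le j\le n$; on $H_p$, $(A,B)\ge(A',B')$ iff $A\ge A'$ and $B\ge B'$; elements of $H_u$ and $H_\xi$ are never comparable; for $I\in H_u$, $I\le(A,B)$ iff $I\le A$; for $J\in H_\xi$, $J\le(A,B)$ iff $J\le B$; no element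 of $H_u$ or $H_\xi$ is greater than an element of $H_p$. $D=H\cup\{\mathbf 1\}\cup\{\mathbf 0\}$, with $\mathbf 1$ the largest and $\mathbf 0$ the smallest element. Functions on $X$: $p(A,B)=\det(\langle u_i,\xi_j\rangle)_{i\in A,j\in B}$, $p(\emptyset,\emptyset)=1$; $u(I)$ is the $n$-minor of $U$ with rows $I$; $\xi(J)$ is the $n$-minor of $W$ with columns $J$. The following relations hold in $K[X]$ (coefficients in $K^*$): (R1) for $I\in H_u,J\in H_\xi$: $u(I)\xi(J)=p(I,J)$. (R2) for non-comparable $I,I'\in H_u$: $u(I)u(I')=\sum_r b_ru(I_r)u(I'_r)$, $I_r\ge$ both $I,I'$, $I'_r\le$ both $I,I'$. (R3) for non-comparable $J,J'\in H_\xi$: $\xi(J)\xi(J')=\sum_sc_s\xi(J_s)\xi(J'_s)$, $J_s\ge$ both $J,J'$, $J'_s\le$ both $J,J'$. (R4) for non-comparable $(A_1,A_2),(B_1,B_2)\in H_p$: $p(A_1,A_2)p(B_1,B_2)=\sum_ia_ip(C_{i1},C_{i2})p(D_{i1},D_{i2})$, $(D_{i1},D_{i2})\in H_p$, $(C_{i1},C_{i2})\in H_p\cup\{(\emptyset,\emptyset)\}$, and for $k=1,2$, $C_{ik}\ge$ both $A_k,B_k$, $D_{ik}\le$ both $A_k,B_k$ (with $\emptyset\ge$ everything). (R5) for $I\in H_u,(A,B)\in H_p$, $A\not\ge I$: $p(A,B)u(I)=\sum_td_tp(A_t,B_t)u(I_t)$, $A_t\ge$ both $A,I$, $I_t\le$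 both $A,I$, $B_t\ge B$. (R6) for $J\in H_\xi,(A,B)\in H_p$, $B\not\ge J$: $p(A,B)\xi(J)=\sum_le_lp(A_l,B_l)\xi(J_l)$, $A_l\ge A$, $B_l\ge$ both $B,J$, $J_l\le$ both $B,J$. The algebra $R(D)$: let $P(D)=K[X(A,B),Y(I),Z(J),X(\mathbf 1),X(\mathbf 0):(A,B)\in H_p,I\in H_u,J\in H_\xi]$, and let $\mathfrak a(D)$ be the homogeneous ideal generated by the relations (R1)-(R6) with $X(A,B),Y(I),Z(J)$ replacing $p(A,B),u(I),\xi(J)$, where (R1) is homogenized as $Y(I)Z(J)=X(I,J)X(\mathbf 0)$, and in (R4) $p(\emptyset,\emptyset)$ is replaced by $X(\mathbf 1)$. $R(D)=P(D)/\mathfrak a(D)$; the classes of $X(A,B),Y(I),Z(J),X(\mathbf 1),X(\mathbf 0)$ are denoted $x(A,B),y(I),z(J),x(\mathbf 1),x(\mathbf 0)$. Standard monomials in $R(D)$: monomials $x(\mathbf 1)^a\,x(A_1,B_1)\cdots x(A_r,B_r)\,y(I_1)\cdots y(I_s)\,x(\mathbf 0)^b$ with $(A_1,B_1)\ge\cdots\ge(A_r,B_r)\ge I_1\ge\cdots\ge I_s$ in $H$, or $x(\mathbf 1)^a\,x(A_1,B_1)\cdots x(A_r,B_r)\,z(J_1)\cdots z(J_t)\,x(\mathbf 0)^b$ with $(A_1,B_1)\ge\cdots\ge(A_r,B_r)\ge J_1\ge\cdots\ge J_t$ in $H$ ($a,b,r,s,t\ge0$). *)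

theory Defs
  imports
    "HOL-Library.Poly_Mapping"
    "HOL-Computational_Algebra.Polynomial"
    "HOL-Algebra.QuotRing"
    "Jordan_Normal_Form.VS_Connect"
begin

section \<open>Tuples and the poset \<open>D\<close>\<close>

text \<open>
  Tuples are lists. Following the 0-based indexing of \<^typ>\<open>'a mat\<close>, the index set
  \<open>{1, ..., k}\<close> is replaced by \<open>{0, ..., k - 1}\<close>.
\<close>

type_synonym tuple = "nat list"

definition inc_tuples :: "nat \<Rightarrow> nat \<Rightarrow> tuple set" where
  "inc_tuples r k = {A. length A = r \<and> sorted_wrt (<) A \<and> set A \<subseteq> {..<k}}"

text \<open>In particular the empty tuple is \<open>\<ge>\<close> every tuple.\<close>

definition tuple_ge :: "tuple \<Rightarrow> tuple \<Rightarrow> bool" where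
  "tuple_ge A A' \<longleftrightarrow> length A \<le> length A' \<and> (\<forall>j<length A. A' ! j \<le> A ! j)"

definition pair_ge :: "tuple \<times> tuple \<Rightarrow> tuple \<times> tuple \<Rightarrow> bool" where
  "pair_ge P P' \<longleftrightarrow> tuple_ge (fst P) (fst P') \<and> tuple_ge (snd P) (snd P')"

definition Hu :: "nat \<Rightarrow> nat \<Rightarrow> tuple set" where
  "Hu n m = inc_tuples n m"

definition Hxi :: "nat \<Rightarrow> nat \<Rightarrow> tuple set" where
  "Hxi n q = inc_tuples n q"

definition Hp :: "nat \<Rightarrow> nat \<Rightarrow> nat \<Rightarrow> (tuple \<times> tuple) set" where
  "Hp n m q = (\<Union>r\<in>{1..n}. inc_tuples r m \<times> inc_tuples r q)"

datatype delem = EP "tuple \<times> tuple" | EU tuple | EXi tuple | EOne | EZero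

definition Dset :: "nat \<Rightarrow> nat \<Rightarrow> nat \<Rightarrow> delem set" where
  "Dset n m q = EP ` Hp n m q \<union> EU ` Hu n m \<union> EXi ` Hxi n q \<union> {EOne, EZero}"

fun D_ge :: "delem \<Rightarrow> delem \<Rightarrow> bool" where
  "D_ge EOne _ = True"
| "D_ge _ EZero = True"
| "D_ge (EU I) (EU I') = tuple_ge I I'"
| "D_ge (EXi J) (EXi J') = tuple_ge J J'"
| "D_ge (EP P) (EP P') = pair_ge P P'"
| "D_ge (EP P) (EU I) = tuple_ge (fst P) I"
| "D_ge (EP P) (EXi J) = tuple_ge (snd P) J"
| "D_ge _ _ = False"


section \<open>Functions on \<open>X\<close>\<close>

text \<open>
  A point of \<open>X\<close> is a pair of matrices \<open>U\<close> (\<open>m \<times> n\<close>, rows \<open>u\<^sub>i\<close>) and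
  \<open>W\<close> (\<open>n \<times> q\<close>, columns \<open>\<xi>\<^sub>j\<close>); the pairing of \<open>u\<^sub>i\<close> and \<open>\<xi>\<^sub>j\<close> is
  \<open>row U i \<bullet> col W j\<close>. As the determinant of the empty matrix is 1,
  \<open>p_fun ([], [])\<close> is the constant 1.
\<close>

definition p_fun :: "tuple \<times> tuple \<Rightarrow> 'k::field mat \<Rightarrow> 'k mat \<Rightarrow> 'k" where
  "p_fun P U W =
     det (mat (length (fst P)) (length (snd P)) (\<lambda>(i, j). row U (fst P ! i) \<bullet> col W (snd P ! j)))"

definition u_fun :: "nat \<Rightarrow> tuple \<Rightarrow> 'k::field mat \<Rightarrow> 'k" where
  "u_fun n I U = det (mat n n (\<lambda>(i, j). U $$ (I ! i, j)))"

definition xi_fun :: "nat \<Rightarrow> tuple \<Rightarrow> 'k::field mat \<Rightarrow> 'k" where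
  "xi_fun n J W = det (mat n n (\<lambda>(i, j). W $$ (i, J ! j)))"


section \<open>Straightening relations in \<open>K[X]\<close>\<close>

text \<open>
  The right-hand sides of the relations (R2)-(R6) are not unique. A \<open>straightening\<close> is a choice
  of such right-hand sides: each is a list of terms, a term consisting of a coefficient and the
  indices of its two factors. In \<open>st_pp\<close> (relation (R4)) the first index of a term may be
  \<open>([], [])\<close>.
\<close>

record 'k straightening =
  st_uu :: "tuple \<Rightarrow> tuple \<Rightarrow> ('k \<times> tuple \<times> tuple) list"
  st_xixi :: "tuple \<Rightarrow> tuple \<Rightarrow> ('k \<times> tuple \<times> tuple) list"
  st_pp :: "tuple \<times> tuple \<Rightarrow> tuple \<times> tuple \<Rightarrow> ('k \<times> (tuple \<times> tuple) \<times> (tuple \<times> tuple)) list"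
  st_pu :: "tuple \<times> tuple \<Rightarrow> tuple \<Rightarrow> ('k \<times> (tuple \<times> tuple) \<times> tuple) list"
  st_pxi :: "tuple \<times> tuple \<Rightarrow> tuple \<Rightarrow> ('k \<times> (tuple \<times> tuple) \<times> tuple) list"

definition rel_R2 :: "nat \<Rightarrow> nat \<Rightarrow> tuple \<Rightarrow> tuple \<Rightarrow> ('k::field \<times> tuple \<times> tuple) list \<Rightarrow> bool" where
  "rel_R2 n m I I' ts \<longleftrightarrow>
     (\<forall>(b, I1, I2)\<in>set ts. b \<noteq> 0 \<and> I1 \<in> Hu n m \<and> I2 \<in> Hu n m \<and>
        tuple_ge I1 I \<and> tuple_ge I1 I' \<and> tuple_ge I I2 \<and> tuple_ge I' I2) \<and>
     (\<forall>U\<in>carrier_mat m n.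
        u_fun n I U * u_fun n I' U = (\<Sum>(b, I1, I2)\<leftarrow>ts. b * u_fun n I1 U * u_fun n I2 U))"

definition rel_R3 :: "nat \<Rightarrow> nat \<Rightarrow> tuple \<Rightarrow> tuple \<Rightarrow> ('k::field \<times> tuple \<times> tuple) list \<Rightarrow> bool" where
  "rel_R3 n q J J' ts \<longleftrightarrow>
     (\<forall>(c, J1, J2)\<in>set ts. c \<noteq> 0 \<and> J1 \<in> Hxi n q \<and> J2 \<in> Hxi n q \<and>
        tuple_ge J1 J \<and> tuple_ge J1 J' \<and> tuple_ge J J2 \<and> tuple_ge J' J2) \<and>
     (\<forall>W\<in>carrier_mat n q.
        xi_fun n J W * xi_fun n J' W = (\<Sum>(c, J1, J2)\<leftarrow>ts. c * xi_fun n J1 W * xi_fun n J2 W))"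

definition rel_R4 :: "nat \<Rightarrow> nat \<Rightarrow> nat \<Rightarrow> tuple \<times> tuple \<Rightarrow> tuple \<times> tuple \<Rightarrow>
    ('k::field \<times> (tuple \<times> tuple) \<times> (tuple \<times> tuple)) list \<Rightarrow> bool" where
  "rel_R4 n m q A B ts \<longleftrightarrow>
     (\<forall>(a, C, D)\<in>set ts. a \<noteq> 0 \<and> C \<in> Hp n m q \<union> {([], [])} \<and> D \<in> Hp n m q \<and>
        tuple_ge (fst C) (fst A) \<and> tuple_ge (fst C) (fst B) \<and>
        tuple_ge (snd C) (snd A) \<and> tuple_ge (snd C) (snd B) \<and>
        tuple_ge (fst A) (fst D) \<and> tuple_ge (fst B) (fst D) \<and>
        tuple_ge (snd A) (snd D) \<and> tuple_ge (snd B) (snd D)) \<and>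
     (\<forall>U\<in>carrier_mat m n. \<forall>W\<in>carrier_mat n q.
        p_fun A U W * p_fun B U W = (\<Sum>(a, C, D)\<leftarrow>ts. a * p_fun C U W * p_fun D U W))"

definition rel_R5 :: "nat \<Rightarrow> nat \<Rightarrow> nat \<Rightarrow> tuple \<times> tuple \<Rightarrow> tuple \<Rightarrow>
    ('k::field \<times> (tuple \<times> tuple) \<times> tuple) list \<Rightarrow> bool" where
  "rel_R5 n m q P I ts \<longleftrightarrow>
     (\<forall>(d, P1, I1)\<in>set ts. d \<noteq> 0 \<and> P1 \<in> Hp n m q \<and> I1 \<in> Hu n m \<and>
        tuple_ge (fst P1) (fst P) \<and> tuple_ge (fst P1) I \<and>
        tuple_ge (fst P) I1 \<and> tuple_ge I I1 \<and> tuple_ge (snd P1) (snd P)) \<and>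
     (\<forall>U\<in>carrier_mat m n. \<forall>W\<in>carrier_mat n q.
        p_fun P U W * u_fun n I U = (\<Sum>(d, P1, I1)\<leftarrow>ts. d * p_fun P1 U W * u_fun n I1 U))"

definition rel_R6 :: "nat \<Rightarrow> nat \<Rightarrow> nat \<Rightarrow> tuple \<times> tuple \<Rightarrow> tuple \<Rightarrow>
    ('k::field \<times> (tuple \<times> tuple) \<times> tuple) list \<Rightarrow> bool" where
  "rel_R6 n m q P J ts \<longleftrightarrow>
     (\<forall>(e, P1, J1)\<in>set ts. e \<noteq> 0 \<and> P1 \<in> Hp n m q \<and> J1 \<in> Hxi n q \<and>
        tuple_ge (fst P1) (fst P) \<and> tuple_ge (snd P1) (snd P) \<and> tuple_ge (snd P1) J \<and>
        tuple_ge (snd P) J1 \<and> tuple_ge J J1) \<and>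
     (\<forall>U\<in>carrier_mat m n. \<forall>W\<in>carrier_mat n q.
        p_fun P U W * xi_fun n J W = (\<Sum>(e, P1, J1)\<leftarrow>ts. e * p_fun P1 U W * xi_fun n J1 W))"

definition noncomp :: "('a \<Rightarrow> 'a \<Rightarrow> bool) \<Rightarrow> 'a set \<Rightarrow> ('a \<times> 'a) set" where
  "noncomp ge S = {(a, b). a \<in> S \<and> b \<in> S \<and> \<not> ge a b \<and> \<not> ge b a}"

definition straightening_relations :: "nat \<Rightarrow> nat \<Rightarrow> nat \<Rightarrow> 'k::field straightening \<Rightarrow> bool" where
  "straightening_relations n m q S \<longleftrightarrow>
     (\<forall>(I, I')\<in>noncomp tuple_ge (Hu n m). rel_R2 n m I I' (st_uu S I I')) \<and>
     (\<forall>(J, J')\<in>noncomp tuple_ge (Hxi n q). rel_R3 n q J J' (st_xixi S J J')) \<and>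
     (\<forall>(A, B)\<in>noncomp pair_ge (Hp n m q). rel_R4 n m q A B (st_pp S A B)) \<and>
     (\<forall>P\<in>Hp n m q. \<forall>I\<in>Hu n m. \<not> tuple_ge (fst P) I \<longrightarrow> rel_R5 n m q P I (st_pu S P I)) \<and>
     (\<forall>P\<in>Hp n m q. \<forall>J\<in>Hxi n q. \<not> tuple_ge (snd P) J \<longrightarrow> rel_R6 n m q P J (st_pxi S P J))"


section \<open>The algebra \<open>R(D)\<close>\<close>

text \<open>
  A polynomial is a finitely supported map from exponent vectors to coefficients;
  multiplication of \<^typ>\<open>'a \<Rightarrow>\<^sub>0 'b\<close> is convolution. The type \<^typ>\<open>delem\<close> contains junk elements
  outside \<open>Dset n m q\<close>, so \<open>P(D)\<close> is the subring of polynomials in the variables from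
  \<open>Dset n m q\<close>.
\<close>

type_synonym 'k dpoly = "(delem \<Rightarrow>\<^sub>0 nat) \<Rightarrow>\<^sub>0 'k"

definition Var :: "delem \<Rightarrow> 'k::field dpoly" where
  "Var d = Poly_Mapping.single (Poly_Mapping.single d 1) 1"

definition Const :: "'k::field \<Rightarrow> 'k dpoly" where
  "Const c = Poly_Mapping.single 0 c"

definition vars :: "'k::field dpoly \<Rightarrow> delem set" where
  "vars f = (\<Union>e\<in>Poly_Mapping.keys f. Poly_Mapping.keys e)"

abbreviation X_One :: "'k::field dpoly" where "X_One \<equiv> Var EOne"
abbreviation X_Zero :: "'k::field dpoly" where "X_Zero \<equiv> Var EZero"
abbreviation Y :: "tuple \<Rightarrow> 'k::field dpoly" where "Y I \<equiv> Var (EU I)"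
abbreviation Z :: "tuple \<Rightarrow> 'k::field dpoly" where "Z J \<equiv> Var (EXi J)"
abbreviation X :: "tuple \<times> tuple \<Rightarrow> 'k::field dpoly" where "X P \<equiv> Var (EP P)"

definition X' :: "tuple \<times> tuple \<Rightarrow> 'k::field dpoly" where
  "X' P = (if P = ([], []) then X_One else X P)"

definition PD :: "nat \<Rightarrow> nat \<Rightarrow> nat \<Rightarrow> 'k::field dpoly ring" where
  "PD n m q = \<lparr>carrier = {f. vars f \<subseteq> Dset n m q}, mult = (*), one = 1, zero = 0, add = (+)\<rparr>"

definition D_relations :: "nat \<Rightarrow> nat \<Rightarrow> nat \<Rightarrow> 'k::field straightening \<Rightarrow> 'k dpoly set" where
  "D_relations n m q S =
     {Y I * Z J - X (I, J) * X_Zero | I J. I \<in> Hu n m \<and> J \<in> Hxi n q} \<union>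
     {Y I * Y I' - (\<Sum>(b, I1, I2)\<leftarrow>st_uu S I I'. Const b * Y I1 * Y I2)
       | I I'. (I, I') \<in> noncomp tuple_ge (Hu n m)} \<union>
     {Z J * Z J' - (\<Sum>(c, J1, J2)\<leftarrow>st_xixi S J J'. Const c * Z J1 * Z J2)
       | J J'. (J, J') \<in> noncomp tuple_ge (Hxi n q)} \<union>
     {X A * X B - (\<Sum>(a, C, D)\<leftarrow>st_pp S A B. Const a * X' C * X D)
       | A B. (A, B) \<in> noncomp pair_ge (Hp n m q)} \<union>
     {X P * Y I - (\<Sum>(d, P1, I1)\<leftarrow>st_pu S P I. Const d * X P1 * Y I1)
       | P I. P \<in> Hp n m q \<and> I \<in> Hu n m \<and> \<not> tuple_ge (fst P) I} \<union>
     {X P * Z J - (\<Sum>(e, P1, J1)\<leftarrow>st_pxi S P J. Const e * X P1 * Z J1)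
       | P J. P \<in> Hp n m q \<and> J \<in> Hxi n q \<and> \<not> tuple_ge (snd P) J}"

definition aD :: "nat \<Rightarrow> nat \<Rightarrow> nat \<Rightarrow> 'k::field straightening \<Rightarrow> 'k dpoly set" where
  "aD n m q S = genideal (PD n m q) (D_relations n m q S)"

definition D_class :: "nat \<Rightarrow> nat \<Rightarrow> nat \<Rightarrow> 'k::field straightening \<Rightarrow> 'k dpoly \<Rightarrow> 'k dpoly set" where
  "D_class n m q S f = a_r_coset (PD n m q) (aD n m q S) f"

text \<open>
  The quotient ring, with the scalar multiplication of a \<open>K\<close>-algebra: a scalar acts as
  multiplication by the class of the constant polynomial.
\<close>

definition RD :: "nat \<Rightarrow> nat \<Rightarrow> nat \<Rightarrow> 'k::field straightening \<Rightarrow> ('k, 'k dpoly set) module" where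
  "RD n m q S = (let Q = PD n m q Quot aD n m q S in
     \<lparr>carrier = carrier Q, mult = mult Q, one = one Q, zero = zero Q, add = add Q,
      smult = (\<lambda>c. mult Q (D_class n m q S (Const c)))\<rparr>)"


section \<open>Standard monomials\<close>

definition std_monomials :: "nat \<Rightarrow> nat \<Rightarrow> nat \<Rightarrow> 'k::field dpoly set" where
  "std_monomials n m q =
     {X_One ^ a * (\<Prod>P\<leftarrow>Ps. X P) * (\<Prod>I\<leftarrow>Is. Y I) * X_Zero ^ b | a b Ps Is.
        set Ps \<subseteq> Hp n m q \<and> set Is \<subseteq> Hu n m \<and> sorted_wrt D_ge (map EP Ps @ map EU Is)} \<union>
     {X_One ^ a * (\<Prod>P\<leftarrow>Ps. X P) * (\<Prod>J\<leftarrow>Js. Z J) * X_Zero ^ b | a b Ps Js.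
        set Ps \<subseteq> Hp n m q \<and> set Js \<subseteq> Hxi n q \<and> sorted_wrt D_ge (map EP Ps @ map EXi Js)}"

end

theory Submission
  imports Defs
begin

text \<open>
Spanning. Every defining relation of \<open>R(D)\<close> has the same shape: it rewrites a product \<open>d e\<close> of two
incomparable elements of \<open>D\<close> as a combination of products \<open>z w\<close> with \<open>z\<close> above both \<open>d\<close> and \<open>e\<close>, and
\<open>w\<close> below both (predicate \<open>straightens\<close>). Conversely, every incomparable pair is rewritten by some
relation (\<open>incomparable_straighten\<close>). Let \<open>h d\<close> be the number of elements of \<open>D\<close> below \<open>d\<close>, and
weigh a monomial by the sum of the numbers \<open>2 ^ h d\<close> over its factors. Since \<open>h z\<close> exceeds both
\<open>h d\<close> and \<open>h e\<close>, each rewriting strictly increases the weight; since it preserves the number of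
factors, the weight is bounded. So the rewriting ends (\<open>cls_var_product_in_span\<close>), and it can only
end at monomials whose factors are pairwise comparable, which are the standard ones
(\<open>var_product_chain\<close>).

Linear independence. A point \<open>(U, W)\<close> of \<open>X\<close> and two further scalars \<open>t\<close>, \<open>s\<close> define an evaluation
\<open>x(1) \<mapsto> t\<close>, \<open>x(0) \<mapsto> s\<close>, \<open>x(A, B) \<mapsto> t p(A, B)\<close>, \<open>y(I) \<mapsto> s u(I)\<close>, \<open>z(J) \<mapsto> t \<xi>(J)\<close>
of \<open>R(D)\<close>; for instance the first relation becomes \<open>(s u(I)) (t \<xi>(J)) = (t p(I, J)) s\<close>. The
scalars keep track of the powers of \<open>x(1)\<close> and \<open>x(0)\<close>. By the Cauchy-Binet expansion the leading term of
\<open>p(A, B)\<close> as a polynomial in the entries of \<open>U\<close> and \<open>W\<close> is the diagonal monomial, the product of all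
\<open>U(a\<^sub>i, i) W(i, b\<^sub>i)\<close> (\<open>product_minor_leading_degree\<close>), and likewise for \<open>u(I)\<close> and \<open>\<xi>(J)\<close>
(\<open>minor_leading_degree\<close>). The leading monomial of a standard monomial therefore records, for each
\<open>i\<close>, the multiset of the \<open>i\<close>-th entries of the rows \<open>A\<^sub>k\<close> and \<open>I\<^sub>l\<close>, and of the rows \<open>B\<^sub>k\<close> and
\<open>J\<^sub>l\<close>. As these rows form chains, they can be recovered from the multisets
(\<open>tableau_mset_inject\<close>), so distinct standard monomials have distinct leading monomials
(\<open>inj_on_list_diagonal\<close>).

To work with polynomials in a single variable \<open>x\<close>, every coordinate is specialised to a power
\<open>x ^ (N ^ k)\<close>, with a different \<open>k\<close> for each coordinate. If \<open>N\<close> is large, the digits of a degree in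
base \<open>N\<close> are the exponents of the corresponding monomial (\<open>mset_power_sum_inject\<close>), so finitely many
standard monomials become polynomials of pairwise distinct degrees, which are linearly independent
(\<open>std_lists_independent\<close>). The relations hold at all points of this curve, hence as identities in
\<open>K[x]\<close>, because \<open>K\<close> is infinite.
\<close>

section \<open>Leading terms of minors along a monomial curve\<close>

lemma inc_tuples_nth_less: "A \<in> inc_tuples r k \<Longrightarrow> i < r \<Longrightarrow> A ! i < k"
  unfolding inc_tuples_def using nth_mem by blast

lemma inc_tuples_mono: "k \<le> k' \<Longrightarrow> inc_tuples r k \<subseteq> inc_tuples r k'"
  by (auto simp: inc_tuples_def)

text \<open>
\<open>w i a\<close> is the weight of the matrix entry in column \<open>i\<close> and row \<open>a\<close> of \<open>U\<close> (for \<open>W\<close>: row \<open>i\<close> and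
column \<open>a\<close>). The condition says that, for products of at most \<open>n\<close> entries, comparing weights amounts
to comparing lexicographically, where an entry comes first if \<open>i\<close> is smaller, and for equal \<open>i\<close> if \<open>a\<close> is
smaller. For this order the leading term of every minor is its diagonal.
\<close>

definition dominating :: "nat \<Rightarrow> nat \<Rightarrow> (nat \<Rightarrow> nat \<Rightarrow> nat) \<Rightarrow> bool" where
  "dominating n M w \<longleftrightarrow> (\<forall>i<n. \<forall>j<n. \<forall>a<M. \<forall>b<M. i < j \<or> i = j \<and> a < b \<longrightarrow> n * w j b < w i a)"

text \<open>
At the first position \<open>k\<close> where \<open>f\<close> leaves the diagonal, injectivity forces \<open>f j \<ge> k\<close> for all
\<open>j \<ge> k\<close>, and \<open>f j = k\<close> only for some \<open>j > k\<close>, whose entry \<open>R ! j\<close> is larger than \<open>R ! k\<close>. So each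
of the at most \<open>n\<close> remaining weights is dominated by the single diagonal weight at \<open>k\<close>.
\<close>

lemma row_weight_less_diagonal:
  assumes dom: "dominating n M w"
    and R: "R \<in> inc_tuples r M" and "r \<le> n"
    and f: "inj_on f {0..<r}" "f \<in> {0..<r} \<rightarrow> {0..<n}"
    and ne: "\<exists>i<r. f i \<noteq> i"
  shows "(\<Sum>i = 0..<r. w (f i) (R ! i)) < (\<Sum>i = 0..<r. w i (R ! i))"
proof -
  define k where "k = (LEAST i. i < r \<and> f i \<noteq> i)"
  have k: "k < r" "f k \<noteq> k" using LeastI_ex[OF ne] unfolding k_def by auto
  have below: "f i = i" if "i < k" for i
    using not_less_Least[OF that[unfolded k_def]] that k(1) by auto
  have len: "length R = r" and inc: "sorted_wrt (<) R" and ent: "set R \<subseteq> {..<M}"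
    using R by (auto simp: inc_tuples_def)
  have each: "n * w (f j) (R ! j) < w k (R ! k)" if j: "k \<le> j" "j < r" for j
  proof -
    have "\<not> f j < k"
    proof
      assume lt: "f j < k"
      then have "f (f j) = f j" by (rule below)
      then have "f j = j" using f(1) lt j k by (auto simp: inj_on_def)
      with lt j show False by simp
    qed
    moreover have "R ! k < R ! j" if "f j = k"
    proof -
      have "k < j" using that j k by (metis le_neq_implies_less)
      then show ?thesis using inc j len by (simp add: sorted_wrt_iff_nth_less)
    qed
    moreover have "f j < n" using f(2) j by auto
    moreover have "R ! k < M" "R ! j < M" using ent len k j nth_mem[of k R] nth_mem[of j R] by blast+
    ultimately show ?thesis using dom k \<open>r \<le> n\<close> unfolding dominating_def by (metis linorder_neqE_nat order_less_le_trans)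
  qed
  have split: "{0..<r} = {0..<k} \<union> {k..<r}" using k by auto
  have "n * (\<Sum>i\<in>{k..<r}. w (f i) (R ! i)) = (\<Sum>i\<in>{k..<r}. n * w (f i) (R ! i))"
    by (simp add: sum_distrib_left)
  also have "\<dots> < (\<Sum>i\<in>{k..<r}. w k (R ! k))"
    using k each by (intro sum_strict_mono) auto
  also have "\<dots> \<le> n * w k (R ! k)" using \<open>r \<le> n\<close> by auto
  finally have "(\<Sum>i\<in>{k..<r}. w (f i) (R ! i)) < w k (R ! k)" by simp
  also have "\<dots> \<le> (\<Sum>i\<in>{k..<r}. w i (R ! i))" using k by (intro member_le_sum) auto
  finally have tail: "(\<Sum>i\<in>{k..<r}. w (f i) (R ! i)) < (\<Sum>i\<in>{k..<r}. w i (R ! i))" .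
  have head: "(\<Sum>i\<in>{0..<k}. w (f i) (R ! i)) = (\<Sum>i\<in>{0..<k}. w i (R ! i))"
    using below by (intro sum.cong) auto
  show ?thesis unfolding split
    using tail head by (subst (1 2) sum.union_disjoint) auto
qed

lemma degree_sum_monom:
  fixes c :: "'i \<Rightarrow> 'k::field"
  assumes "finite I" "k \<in> I" "c k \<noteq> 0" "\<And>i. i \<in> I \<Longrightarrow> i \<noteq> k \<Longrightarrow> w i < w k"
  shows "(\<Sum>i\<in>I. monom (c i) (w i)) \<noteq> 0 \<and> degree (\<Sum>i\<in>I. monom (c i) (w i)) = w k"
proof -
  let ?Q = "\<Sum>i\<in>I. monom (c i) (w i)"
  have "coeff ?Q (w k) = (\<Sum>i\<in>I. if i = k then c k else 0)"
    unfolding coeff_sum using assms(4) by (intro sum.cong) (force simp: coeff_monom)+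
  also have "\<dots> = c k" using assms by simp
  finally have c: "coeff ?Q (w k) \<noteq> 0" using assms(3) by simp
  have "degree ?Q \<le> w k"
    using assms(1,4) by (intro degree_sum_le) (auto intro: order_trans[OF degree_monom_le] less_imp_le)
  with c show ?thesis by (metis coeff_0 le_degree order_antisym)
qed

text \<open>
The terms of the Leibniz formula become monomials in \<open>x\<close>, and the identity permutation is the only one
that attains the largest degree, so the leading term cannot cancel.
\<close>

lemma minor_leading_degree:
  fixes w :: "nat \<Rightarrow> nat \<Rightarrow> nat"
  assumes "dominating n M w" "R \<in> inc_tuples n M"
  obtains Q :: "'k::field poly" where "Q \<noteq> 0" "degree Q = (\<Sum>i = 0..<n. w i (R ! i))"
    "\<And>x. poly Q x = det (mat n n (\<lambda>(i, j). x ^ w j (R ! i)))"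
proof -
  let ?T = "{\<tau>. \<tau> permutes {0..<n}}"
  let ?w = "\<lambda>\<tau>. \<Sum>i = 0..<n. w (\<tau> i) (R ! i)"
  define Q :: "'k poly" where "Q = (\<Sum>\<tau>\<in>?T. monom (signof \<tau>) (?w \<tau>))"
  have "Q \<noteq> 0 \<and> degree Q = ?w id"
    unfolding Q_def
  proof (rule degree_sum_monom)
    fix \<tau> assume \<tau>: "\<tau> \<in> ?T" "\<tau> \<noteq> id"
    then have "inj_on \<tau> {0..<n}" by (auto simp: permutes_inj_on)
    moreover have "\<tau> \<in> {0..<n} \<rightarrow> {0..<n}"
      using \<tau> permutes_in_image[of \<tau> "{0..<n}"] by (intro funcsetI) blast
    moreover have "\<exists>i<n. \<tau> i \<noteq> i"
      using \<tau> by (auto simp: permutes_def fun_eq_iff)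
    ultimately show "?w \<tau> < ?w id"
      using row_weight_less_diagonal[OF assms(1,2)] by auto
  qed (auto simp: finite_permutations permutes_id[unfolded id_def] sign_id)
  moreover have "poly Q x = det (mat n n (\<lambda>(i, j). x ^ w j (R ! i)))" for x
    unfolding Q_def poly_sum poly_monom power_sum
    by (subst det_def'[of _ n]) (auto intro!: sum.cong prod.cong dest: permutes_in_image)
  ultimately show ?thesis using that[of Q] by simp
qed

text \<open>
A form of the Cauchy-Binet formula in which the set of column indices is listed by an injection \<open>f\<close>, so
that the terms are indexed by pairs \<open>(f, \<tau>)\<close>. Expanding the product of sums gives arbitrary functions
\<open>f\<close>; for one that is not injective the inner sum is a determinant with two equal rows.
\<close>

lemma det_matrix_product_expansion:
  fixes F G :: "nat \<Rightarrow> nat \<Rightarrow> 'a::comm_ring_1"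
  shows "det (mat r r (\<lambda>(i, j). \<Sum>k = 0..<n. F i k * G k j)) =
    (\<Sum>(f, \<tau>)\<in>{f \<in> {0..<r} \<rightarrow>\<^sub>E {0..<n}. inj_on f {0..<r}} \<times> {\<tau>. \<tau> permutes {0..<r}}.
       signof \<tau> * ((\<Prod>i = 0..<r. F i (f i)) * (\<Prod>i = 0..<r. G (f i) (\<tau> i))))"
proof -
  let ?T = "{\<tau>. \<tau> permutes {0..<r}}" and ?E = "{0..<r} \<rightarrow>\<^sub>E {0..<n}"
  have finE: "finite ?E" by (intro finite_PiE) auto
  have zero: "(\<Sum>\<tau>\<in>?T. signof \<tau> * (\<Prod>i = 0..<r. G (f i) (\<tau> i))) = 0"
    if not_inj: "\<not> inj_on f {0..<r}" for f
  proof -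
    let ?A = "mat r r (\<lambda>(i, j). G (f i) j)"
    obtain i j where ij: "i < r" "j < r" "i \<noteq> j" "f i = f j"
      using not_inj unfolding inj_on_def by (metis atLeastLessThan_iff)
    have "row ?A i = row ?A j" using ij by (intro eq_vecI) auto
    then have "det ?A = 0" using det_identical_rows[of ?A r i j] ij by auto
    moreover have "det ?A = (\<Sum>\<tau>\<in>?T. signof \<tau> * (\<Prod>i = 0..<r. G (f i) (\<tau> i)))"
      by (subst det_def'[of _ r]) (auto intro!: sum.cong prod.cong dest: permutes_in_image)
    ultimately show ?thesis by simp
  qed
  have "det (mat r r (\<lambda>(i, j). \<Sum>k = 0..<n. F i k * G k j)) =
      (\<Sum>\<tau>\<in>?T. signof \<tau> * (\<Prod>i = 0..<r. \<Sum>k = 0..<n. F i k * G k (\<tau> i)))"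
    by (subst det_def'[of _ r]) (auto intro!: sum.cong prod.cong dest: permutes_in_image)
  also have "\<dots> = (\<Sum>\<tau>\<in>?T. \<Sum>f\<in>?E. signof \<tau> * (\<Prod>i = 0..<r. F i (f i) * G (f i) (\<tau> i)))"
    by (subst prod_sum_PiE) (auto simp: sum_distrib_left)
  also have "\<dots> = (\<Sum>f\<in>?E. \<Sum>\<tau>\<in>?T. signof \<tau> * (\<Prod>i = 0..<r. F i (f i) * G (f i) (\<tau> i)))"
    by (rule sum.swap)
  also have "\<dots> = (\<Sum>f\<in>?E. (\<Prod>i = 0..<r. F i (f i)) * (\<Sum>\<tau>\<in>?T. signof \<tau> * (\<Prod>i = 0..<r. G (f i) (\<tau> i))))"
    by (simp add: prod.distrib sum_distrib_left ac_simps)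
  also have "\<dots> = (\<Sum>f\<in>{f \<in> ?E. inj_on f {0..<r}}.
      (\<Prod>i = 0..<r. F i (f i)) * (\<Sum>\<tau>\<in>?T. signof \<tau> * (\<Prod>i = 0..<r. G (f i) (\<tau> i))))"
    using finE zero by (intro sum.mono_neutral_right) auto
  finally show ?thesis
    by (simp add: sum_distrib_left sum.cartesian_product ac_simps)
qed

text \<open>
In the expansion over pairs \<open>(f, \<tau>)\<close> the factors from \<open>A\<close> have weight governed by the injection \<open>f\<close>, and
after reindexing those from \<open>B\<close> by the injection \<open>f \<circ> \<tau>\<^sup>-\<^sup>1\<close>. Each weight is maximal only if its
injection is the inclusion, so their sum is maximal only for \<open>f\<close> the inclusion and \<open>\<tau> = id\<close>.
\<close>

lemma product_minor_leading_degree: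
  fixes w w' :: "nat \<Rightarrow> nat \<Rightarrow> nat"
  assumes "dominating n M w" "dominating n M w'" "A \<in> inc_tuples r M" "B \<in> inc_tuples r M" "r \<le> n"
  obtains Q :: "'k::field poly" where "Q \<noteq> 0"
    "degree Q = (\<Sum>i = 0..<r. w i (A ! i)) + (\<Sum>i = 0..<r. w' i (B ! i))"
    "\<And>x. poly Q x = det (mat r r (\<lambda>(i, j). \<Sum>k = 0..<n. x ^ w k (A ! i) * x ^ w' k (B ! j)))"
proof -
  let ?I = "{f \<in> {0..<r} \<rightarrow>\<^sub>E {0..<n}. inj_on f {0..<r}} \<times> {\<tau>. \<tau> permutes {0..<r}}"
  define wt where "wt = (\<lambda>(f, \<tau>). (\<Sum>i = 0..<r. w (f i) (A ! i)) + (\<Sum>i = 0..<r. w' (f i) (B ! \<tau> i)))"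
  define Q :: "'k poly" where "Q = (\<Sum>z\<in>?I. monom (signof (snd z)) (wt z))"
  let ?k = "(restrict id {0..<r}, id)"
  have wt_eq: "wt (f, \<tau>) = (\<Sum>i = 0..<r. w (f i) (A ! i)) + (\<Sum>j = 0..<r. w' (f (Hilbert_Choice.inv \<tau> j)) (B ! j))"
    if "\<tau> permutes {0..<r}" for f \<tau>
    using sum.permute[OF that, of "\<lambda>j. w' (f (Hilbert_Choice.inv \<tau> j)) (B ! j)"] permutes_inverses(2)[OF that]
    by (simp add: wt_def comp_def)
  have wt_k: "wt ?k = (\<Sum>i = 0..<r. w i (A ! i)) + (\<Sum>j = 0..<r. w' j (B ! j))"
    by (simp add: wt_def)
  have fin: "finite ?I"
    by (intro finite_cartesian_product finite_permutations finite_subset[OF _ finite_PiE[of "{0..<r}" "\<lambda>_. {0..<n}"]]) auto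
  have "Q \<noteq> 0 \<and> degree Q = wt ?k"
    unfolding Q_def
  proof (rule degree_sum_monom[OF fin])
    fix z assume z: "z \<in> ?I" "z \<noteq> ?k"
    obtain f \<tau> where z': "z = (f, \<tau>)" by (cases z)
    have f: "inj_on f {0..<r}" "f \<in> {0..<r} \<rightarrow> {0..<n}" "f \<in> extensional {0..<r}"
      and \<tau>: "\<tau> permutes {0..<r}" using z z' by (auto simp: PiE_def)
    note inv = permutes_inv[OF \<tau>]
    have g: "inj_on (\<lambda>j. f (Hilbert_Choice.inv \<tau> j)) {0..<r}" "(\<lambda>j. f (Hilbert_Choice.inv \<tau> j)) \<in> {0..<r} \<rightarrow> {0..<n}"
      using comp_inj_on[of "Hilbert_Choice.inv \<tau>" "{0..<r}" f] f inv
      by (auto simp: permutes_inj_on permutes_image comp_def Pi_iff permutes_in_image)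
    have ltU: "(\<Sum>i = 0..<r. w (f i) (A ! i)) < (\<Sum>i = 0..<r. w i (A ! i))" if "\<exists>i<r. f i \<noteq> i"
      by (rule row_weight_less_diagonal[OF assms(1,3,5) f(1,2) that])
    have ltW: "(\<Sum>j = 0..<r. w' (f (Hilbert_Choice.inv \<tau> j)) (B ! j)) < (\<Sum>j = 0..<r. w' j (B ! j))"
      if "\<exists>j<r. f (Hilbert_Choice.inv \<tau> j) \<noteq> j"
      by (rule row_weight_less_diagonal[OF assms(2,4,5) g that])
    have leW: "(\<Sum>j = 0..<r. w' (f (Hilbert_Choice.inv \<tau> j)) (B ! j)) \<le> (\<Sum>j = 0..<r. w' j (B ! j))"
      using ltW by (cases "\<exists>j<r. f (Hilbert_Choice.inv \<tau> j) \<noteq> j") (auto intro!: sum_mono)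
    show "wt z < wt ?k"
    proof (cases "\<exists>i<r. f i \<noteq> i")
      case True
      then show ?thesis using ltU leW by (simp add: z' wt_eq[OF \<tau>] wt_k)
    next
      case False
      then have id: "f i = i" if "i < r" for i using that by auto
      have "f = restrict id {0..<r}" using f(3) id by (auto simp: fun_eq_iff extensional_def)
      then have "\<tau> \<noteq> id" using z z' by auto
      then have "Hilbert_Choice.inv \<tau> \<noteq> id" using \<tau> by (metis inv_id permutes_inv_inv)
      then obtain j where "Hilbert_Choice.inv \<tau> j \<noteq> j" by (auto simp: fun_eq_iff)
      then have "j < r" "Hilbert_Choice.inv \<tau> j < r"
        using inv permutes_in_image[OF inv, of j] by (auto simp: permutes_def)
      then have "\<exists>j<r. f (Hilbert_Choice.inv \<tau> j) \<noteq> j" using id \<open>Hilbert_Choice.inv \<tau> j \<noteq> j\<close> by auto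
      moreover have "(\<Sum>i = 0..<r. w (f i) (A ! i)) = (\<Sum>i = 0..<r. w i (A ! i))" using id by simp
      ultimately show ?thesis using ltW by (simp add: z' wt_eq[OF \<tau>] wt_k)
    qed
  qed (use \<open>r \<le> n\<close> in \<open>auto simp: permutes_id sign_id inj_on_def\<close>)
  then have "Q \<noteq> 0" "degree Q = wt ?k" by blast+
  moreover have "poly Q x = det (mat r r (\<lambda>(i, j). \<Sum>k = 0..<n. x ^ w k (A ! i) * x ^ w' k (B ! j)))" for x
    unfolding det_matrix_product_expansion Q_def poly_sum
    by (intro sum.cong) (auto simp: poly_monom wt_def power_add power_sum)
  ultimately show ?thesis using that[of Q] wt_k by simp
qed

section \<open>Coordinates and their weights\<close>

text \<open>
The coordinates of the evaluation: \<open>Ucoord i a\<close> is the entry of \<open>U\<close> in row \<open>a\<close> and column \<open>i\<close>,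
\<open>Wcoord i b\<close> the entry of \<open>W\<close> in row \<open>i\<close> and column \<open>b\<close>, and \<open>Tcoord\<close>, \<open>Scoord\<close> are the two
scalars \<open>t\<close> and \<open>s\<close>. The index \<open>i\<close> in \<open>{0..<n}\<close> comes first in both cases, as the two matrices play
symmetric roles.
\<close>

datatype coord = Ucoord nat nat | Wcoord nat nat | Tcoord | Scoord

definition entry_rank :: "nat \<Rightarrow> nat \<Rightarrow> nat \<Rightarrow> nat \<Rightarrow> nat" where
  "entry_rank n M i a = (n - 1 - i) * M + (M - 1 - a)"

text \<open>
The residue modulo 2 separates the entries of \<open>U\<close> from those of \<open>W\<close>, which makes all ranks distinct while
preserving the order on the entries of each matrix.
\<close>

fun coord_rank :: "nat \<Rightarrow> nat \<Rightarrow> coord \<Rightarrow> nat" where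
  "coord_rank n M Tcoord = 0"
| "coord_rank n M Scoord = 1"
| "coord_rank n M (Ucoord i a) = 2 * entry_rank n M i a + 2"
| "coord_rank n M (Wcoord i b) = 2 * entry_rank n M i b + 3"

definition coords :: "nat \<Rightarrow> nat \<Rightarrow> coord set" where
  "coords n M = {Tcoord, Scoord} \<union> case_prod Ucoord ` ({..<n} \<times> {..<M}) \<union> case_prod Wcoord ` ({..<n} \<times> {..<M})"

lemma entry_rank_less:
  assumes "i < n" "j < n" "a < M" "b < M" "i < j \<or> i = j \<and> a < b"
  shows "entry_rank n M j b < entry_rank n M i a"
proof (cases "i = j")
  case False
  then have "n - 1 - j + 1 \<le> n - 1 - i" using assms by auto
  then have "(n - 1 - j + 1) * M \<le> (n - 1 - i) * M" by (rule mult_le_mono1)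
  then show ?thesis using assms by (simp add: entry_rank_def)
qed (use assms in \<open>auto simp: entry_rank_def\<close>)

lemma entry_rank_inject:
  assumes "i < n" "j < n" "a < M" "b < M" "entry_rank n M i a = entry_rank n M j b"
  shows "i = j \<and> a = b"
  using entry_rank_less[of i n j a M b] entry_rank_less[of j n i b M a] assms
  by (metis less_irrefl linorder_neqE_nat)

lemma inj_on_coord_rank: "inj_on (coord_rank n M) (coords n M)"
proof -
  have "2 * a + 2 \<noteq> 2 * b + 3" "2 * a + 3 \<noteq> 2 * b + (2::nat)" for a b by presburger+
  then show ?thesis unfolding inj_on_def coords_def by (auto dest: entry_rank_inject)
qed

definition coord_weight :: "nat \<Rightarrow> nat \<Rightarrow> nat \<Rightarrow> coord \<Rightarrow> nat" where
  "coord_weight N n M c = N ^ coord_rank n M c"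

lemma dominating_coord_weight:
  assumes "n < N"
  shows "dominating n M (\<lambda>i a. coord_weight N n M (Ucoord i a))"
    and "dominating n M (\<lambda>i a. coord_weight N n M (Wcoord i a))"
proof -
  have *: "n * N ^ p < N ^ p'" if "p < p'" for p p'
  proof -
    have "n * N ^ p < N ^ Suc p" using assms by simp
    also have "\<dots> \<le> N ^ p'" using that assms by (intro power_increasing) auto
    finally show ?thesis .
  qed
  show "dominating n M (\<lambda>i a. coord_weight N n M (Ucoord i a))"
    and "dominating n M (\<lambda>i a. coord_weight N n M (Wcoord i a))"
    unfolding dominating_def coord_weight_def
    using assms by (auto intro!: * simp del: power_Suc simp: entry_rank_less)
qed

lemma mset_power_sum_less:
  fixes A :: "nat multiset" and N L :: nat
  assumes "size A < N" and "\<forall>p\<in>#A. p < L"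
  shows "(\<Sum>p\<in>#A. N ^ p) < N ^ L"
proof -
  have N: "N > 0" using assms by auto
  have "(\<Sum>p\<in>#A. N ^ p) * N \<le> size A * N ^ L"
    using assms(2)
  proof (induction A)
    case (add p A)
    have "N * N ^ p \<le> N ^ L"
      using add.prems N by (metis Suc_leI One_nat_def add_mset_eq_singleton_iff insertCI less_Suc_eq_le
          not_less_eq_eq power_Suc power_increasing set_mset_add_mset_insert)
    moreover have "(\<Sum>p\<in>#A. N ^ p) * N \<le> size A * N ^ L" using add by auto
    ultimately have "N * N ^ p + (\<Sum>p\<in>#A. N ^ p) * N \<le> N ^ L + size A * N ^ L" by (rule add_mono)
    moreover have "(\<Sum>p\<in>#add_mset p A. N ^ p) * N = N * N ^ p + (\<Sum>p\<in>#A. N ^ p) * N"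
      unfolding image_mset_add_mset sum_mset.add_mset by (rule trans[OF distrib_right]) simp
    ultimately show ?case by simp
  qed simp
  also have "\<dots> < N ^ L * N" using assms(1) N by simp
  finally show ?thesis by simp
qed

text \<open>
Uniqueness of the expansion in base \<open>N\<close>: the multiplicity of \<open>p\<close> is the digit of the sum at \<open>N ^ p\<close>, as
multiplicities are smaller than \<open>N\<close>. The proof splits off the leading digit.
\<close>

lemma mset_power_sum_inject:
  fixes A B :: "nat multiset" and N :: nat
  assumes "size A < N" and "size B < N" and "(\<Sum>p\<in>#A. N ^ p) = (\<Sum>p\<in>#B. N ^ p)"
  shows "A = B"
proof -
  obtain L where "\<forall>p\<in>#A + B. p < L"
    using finite_nat_set_iff_bounded[of "set_mset (A + B)"] by auto
  then show ?thesis using assms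
  proof (induction L arbitrary: A B)
    case (Suc L)
    let ?A = "filter_mset (\<lambda>p. p \<noteq> L) A" and ?B = "filter_mset (\<lambda>p. p \<noteq> L) B"
    have split: "C = replicate_mset (count C L) L + filter_mset (\<lambda>p. p \<noteq> L) C" for C :: "nat multiset"
      by (rule multiset_eqI) auto
    have sA: "size ?A < N" "size ?B < N"
      using Suc.prems(2,3) size_filter_mset_lesseq le_less_trans by blast+
    have bnd: "\<forall>p\<in>#?A + ?B. p < L" using Suc.prems(1) by (auto simp: less_Suc_eq)
    have lt: "(\<Sum>p\<in>#?A. N ^ p) < N ^ L" "(\<Sum>p\<in>#?B. N ^ p) < N ^ L"
      using mset_power_sum_less[OF sA(1)] mset_power_sum_less[OF sA(2)] bnd by auto
    have sp: "(\<Sum>p\<in>#C. N ^ p) = count C L * N ^ L + (\<Sum>p\<in>#filter_mset (\<lambda>p. p \<noteq> L) C. N ^ p)" for C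
      by (subst split[of C]) simp
    have eq: "count A L * N ^ L + (\<Sum>p\<in>#?A. N ^ p) = count B L * N ^ L + (\<Sum>p\<in>#?B. N ^ p)"
      using Suc.prems(4) unfolding sp[of A] sp[of B] .
    have "(c * K + s) div K = c" if "s < K" for c K s :: nat using that by simp
    from this[OF lt(1)] this[OF lt(2)] have c: "count A L = count B L" using eq by metis
    with eq have "(\<Sum>p\<in>#?A. N ^ p) = (\<Sum>p\<in>#?B. N ^ p)" by simp
    then have "?A = ?B" by (rule Suc.IH[OF bnd sA])
    with c show ?case by (metis split)
  next
    case 0
    then show ?case by (metis multiset_nonemptyE not_less_zero union_iff)
  qed
qed

section \<open>Chains of rows are determined by their columns\<close>

text \<open>
Rows of different lengths are aligned on the left; \<open>(i, x)\<close> occurs once for each row with \<open>i\<close>-th entry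
\<open>x\<close>.
\<close>

definition tableau_mset :: "tuple list \<Rightarrow> (nat \<times> nat) multiset" where
  "tableau_mset Rs = (\<Sum>R\<leftarrow>Rs. mset (List.enumerate 0 R))"

lemma tableau_mset_simps [simp]:
  "tableau_mset [] = {#}"
  "tableau_mset (R # Rs) = mset (List.enumerate 0 R) + tableau_mset Rs"
  "tableau_mset (Rs @ Rs') = tableau_mset Rs + tableau_mset Rs'"
  by (simp_all add: tableau_mset_def)

lemma in_tableau_mset_iff:
  "(i, x) \<in># tableau_mset Rs \<longleftrightarrow> (\<exists>R\<in>set Rs. i < length R \<and> R ! i = x)"
  by (induction Rs) (auto simp: in_set_enumerate_eq)

text \<open>
In a chain for \<open>tuple_ge\<close> the last row is the longest one and has the smallest entry in each column, so
it can be read off from the columns.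
\<close>

lemma tableau_last_row:
  assumes "sorted_wrt tuple_ge (Rs @ [L])"
  shows "i < length L \<longleftrightarrow> (\<exists>x. (i, x) \<in># tableau_mset (Rs @ [L]))"
    and "i < length L \<Longrightarrow> L ! i = Min {x. (i, x) \<in># tableau_mset (Rs @ [L])}"
proof -
  have *: "i < length L \<and> L ! i \<le> x" if "(i, x) \<in># tableau_mset (Rs @ [L])" for i x
  proof -
    obtain R where R: "R \<in> set (Rs @ [L])" "i < length R" "R ! i = x"
      using \<open>(i, x) \<in># tableau_mset (Rs @ [L])\<close> unfolding in_tableau_mset_iff by blast
    then have "R = L \<or> tuple_ge R L" using assms by (auto simp: sorted_wrt_append)
    with R show ?thesis by (auto simp: tuple_ge_def)
  qed
  have **: "(i, L ! i) \<in># tableau_mset (Rs @ [L])" if "i < length L" for i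
    unfolding in_tableau_mset_iff using that by auto
  show "i < length L \<longleftrightarrow> (\<exists>x. (i, x) \<in># tableau_mset (Rs @ [L]))"
    using * ** by blast
  have "finite (snd ` set_mset (tableau_mset (Rs @ [L])))" by simp
  moreover have "{x. (i, x) \<in># tableau_mset (Rs @ [L])} \<subseteq> snd ` set_mset (tableau_mset (Rs @ [L]))"
    by force
  ultimately have "finite {x. (i, x) \<in># tableau_mset (Rs @ [L])}" by (metis finite_subset)
  then show "i < length L \<Longrightarrow> L ! i = Min {x. (i, x) \<in># tableau_mset (Rs @ [L])}"
    using * ** by (intro Min_eqI[symmetric]) auto
qed

text \<open>
Peel off the last row, which both chains share, and continue. Empty rows leave no trace in the columns
and have to be excluded.
\<close>

lemma tableau_mset_inject:
  assumes "sorted_wrt tuple_ge Rs" and "sorted_wrt tuple_ge Rs'"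
    and "[] \<notin> set Rs" and "[] \<notin> set Rs'"
    and "tableau_mset Rs = tableau_mset Rs'"
  shows "Rs = Rs'"
  using assms
proof (induction Rs arbitrary: Rs' rule: rev_induct)
  case Nil
  then show ?case by (cases Rs') (auto simp: enumerate_eq_zip)
next
  case (snoc L Rs)
  have "Rs' \<noteq> []" using snoc.prems by (auto simp: enumerate_eq_zip)
  then obtain Rs'' L' where R': "Rs' = Rs'' @ [L']" by (metis rev_exhaust)
  note l = tableau_last_row[OF snoc.prems(1)]
  note l' = tableau_last_row[OF snoc.prems(2)[unfolded R']]
  have eq: "tableau_mset (Rs @ [L]) = tableau_mset (Rs'' @ [L'])" using snoc.prems(5) R' by simp
  have lt: "i < length L \<longleftrightarrow> i < length L'" for i unfolding l(1) l'(1) eq ..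
  then have len: "length L = length L'" by (metis linorder_neqE_nat less_irrefl)
  have "L = L'"
    by (rule nth_equalityI[OF len]) (metis l(2) l'(2) eq lt)
  moreover have "Rs = Rs''"
    using snoc.prems R' eq \<open>L = L'\<close> by (intro snoc.IH) (auto simp: sorted_wrt_append)
  ultimately show ?case using R' by simp
qed

section \<open>Substituting polynomials for the variables\<close>

definition monomial_value :: "('v \<Rightarrow> 'a::comm_ring_1) \<Rightarrow> ('v \<Rightarrow>\<^sub>0 nat) \<Rightarrow> 'a" where
  "monomial_value v e = (\<Prod>d\<in>Poly_Mapping.keys e. v d ^ Poly_Mapping.lookup e d)"

definition poly_subst :: "('v \<Rightarrow> 'k::field poly) \<Rightarrow> (('v \<Rightarrow>\<^sub>0 nat) \<Rightarrow>\<^sub>0 'k) \<Rightarrow> 'k poly" where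
  "poly_subst v f = (\<Sum>e\<in>Poly_Mapping.keys f. Polynomial.smult (Poly_Mapping.lookup f e) (monomial_value v e))"

lemma monomial_value_superset:
  assumes "finite A" "Poly_Mapping.keys e \<subseteq> A"
  shows "monomial_value v e = (\<Prod>d\<in>A. v d ^ Poly_Mapping.lookup e d)"
  unfolding monomial_value_def using assms
  by (intro prod.mono_neutral_left) (auto simp: in_keys_iff)

lemma monomial_value_add: "monomial_value v (e + e') = monomial_value v e * monomial_value v e'"
proof -
  let ?A = "Poly_Mapping.keys e \<union> Poly_Mapping.keys e'"
  have "finite ?A" by simp
  then show ?thesis
    using Poly_Mapping.keys_add[of e e']
    by (simp add: monomial_value_superset[of ?A] lookup_add power_add prod.distrib)
qed

lemma poly_subst_superset:
  assumes "finite A" "Poly_Mapping.keys f \<subseteq> A"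
  shows "poly_subst v f = (\<Sum>e\<in>A. Polynomial.smult (Poly_Mapping.lookup f e) (monomial_value v e))"
  unfolding poly_subst_def using assms
  by (intro sum.mono_neutral_left) (auto simp: in_keys_iff)

lemma poly_subst_add: "poly_subst v (f + g) = poly_subst v f + poly_subst v g"
proof -
  let ?A = "Poly_Mapping.keys f \<union> Poly_Mapping.keys g"
  have "finite ?A" by simp
  then show ?thesis
    using Poly_Mapping.keys_add[of f g]
    by (simp add: poly_subst_superset[of ?A] lookup_add smult_add_left sum.distrib)
qed

lemma poly_subst_zero [simp]: "poly_subst v 0 = 0"
  by (simp add: poly_subst_def)

lemma poly_subst_diff: "poly_subst v (f - g) = poly_subst v f - poly_subst v g"
  using poly_subst_add[of v "f - g" g] by simp

lemma poly_subst_sum: "poly_subst v (\<Sum>i\<in>I. f i) = (\<Sum>i\<in>I. poly_subst v (f i))"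
  by (induction I rule: infinite_finite_induct) (simp_all add: poly_subst_add)

lemma poly_subst_single:
  "poly_subst v (Poly_Mapping.single e c) = Polynomial.smult c (monomial_value v e)"
  by (simp add: poly_subst_def)

lemma sum_singles: "(\<Sum>e\<in>Poly_Mapping.keys f. Poly_Mapping.single e (Poly_Mapping.lookup f e)) = f"
  by (rule poly_mapping_eqI) (auto simp: lookup_sum lookup_single when_def in_keys_iff)

text \<open>
By bilinearity this reduces to single monomials, where it is the rule \<open>monomial_value_add\<close>.
\<close>

lemma poly_subst_mult: "poly_subst v (f * g) = poly_subst v f * poly_subst v g"
proof -
  let ?l = Poly_Mapping.lookup and ?k = Poly_Mapping.keys
  have "f * g = (\<Sum>e\<in>?k f. Poly_Mapping.single e (?l f e)) * (\<Sum>e\<in>?k g. Poly_Mapping.single e (?l g e))"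
    by (simp only: sum_singles)
  also have "\<dots> = (\<Sum>e\<in>?k f. \<Sum>e'\<in>?k g. Poly_Mapping.single (e + e') (?l f e * ?l g e'))"
    by (simp add: sum_product mult_single)
  finally show ?thesis
    unfolding poly_subst_def[of v f] poly_subst_def[of v g]
    by (simp add: poly_subst_sum poly_subst_single sum_product monomial_value_add ac_simps)
qed

lemma poly_subst_Var [simp]: "poly_subst v (Var d) = v d"
  by (simp add: Var_def poly_subst_single monomial_value_def)

lemma poly_subst_Const [simp]: "poly_subst v (Const c) = [:c:]"
  by (simp add: Const_def poly_subst_single monomial_value_def)

lemma poly_subst_one [simp]: "poly_subst v 1 = 1"
  by (simp add: poly_subst_single monomial_value_def one_pCons flip: single_one)

section \<open>The common shape of the straightening relations\<close>

text \<open>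
Evaluation of the generators of \<open>R(D)\<close> at the point \<open>(U, W)\<close> and the scalars \<open>t\<close>, \<open>s\<close>. The factors
\<open>t\<close> and \<open>s\<close> are distributed so that all relations remain valid: both sides of each relation have the
same degree in \<open>t\<close> and the same degree in \<open>s\<close>.
\<close>

fun point_value :: "nat \<Rightarrow> 'k::field mat \<Rightarrow> 'k mat \<Rightarrow> 'k \<Rightarrow> 'k \<Rightarrow> delem \<Rightarrow> 'k" where
  "point_value n U W t s EOne = t"
| "point_value n U W t s EZero = s"
| "point_value n U W t s (EP P) = t * p_fun P U W"
| "point_value n U W t s (EU I) = s * u_fun n I U"
| "point_value n U W t s (EXi J) = t * xi_fun n J W"

definition quadratic_form :: "('k::field \<times> delem \<times> delem) list \<Rightarrow> 'k dpoly" where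
  "quadratic_form ts = (\<Sum>(c, z, w)\<leftarrow>ts. Const c * Var z * Var w)"

text \<open>
What the six families of relations have in common. Both arguments below use the relations only through
this predicate: spanning uses the position of \<open>z\<close> and \<open>w\<close> in the order, independence uses that the
identity holds at all points.
\<close>

definition straightens ::
  "nat \<Rightarrow> nat \<Rightarrow> nat \<Rightarrow> delem \<Rightarrow> delem \<Rightarrow> ('k::field \<times> delem \<times> delem) list \<Rightarrow> bool" where
  "straightens n m q d e ts \<longleftrightarrow>
     d \<in> Dset n m q \<and> e \<in> Dset n m q \<and>
     (\<forall>(c, z, w)\<in>set ts. z \<in> Dset n m q \<and> w \<in> Dset n m q \<and>
        D_ge z d \<and> D_ge z e \<and> D_ge d w \<and> D_ge e w) \<and>
     (\<forall>U\<in>carrier_mat m n. \<forall>W\<in>carrier_mat n q. \<forall>t s.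
        point_value n U W t s d * point_value n U W t s e =
        (\<Sum>(c, z, w)\<leftarrow>ts. c * point_value n U W t s z * point_value n U W t s w))"

lemma tuple_ge_refl [simp]: "tuple_ge A A"
  by (simp add: tuple_ge_def)

lemma tuple_ge_trans: "tuple_ge A B \<Longrightarrow> tuple_ge B C \<Longrightarrow> tuple_ge A C"
  unfolding tuple_ge_def by (meson order_less_le_trans order_trans)

lemma empty_tuple_ge [simp]: "tuple_ge [] A"
  by (simp add: tuple_ge_def)

lemma p_fun_empty [simp]: "p_fun ([], []) U W = 1"
  by (simp add: p_fun_def)

text \<open>
Multiplicativity of the determinant: the matrix of the pairings is the product of the \<open>n\<close> rows of \<open>U\<close>
with the \<open>n\<close> columns of \<open>W\<close>.
\<close>

lemma u_fun_mult_xi_fun: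
  assumes "U \<in> carrier_mat m n" "W \<in> carrier_mat n q" "I \<in> inc_tuples n m" "J \<in> inc_tuples n q"
  shows "u_fun n I U * xi_fun n J W = p_fun (I, J) U W"
proof -
  let ?U = "mat n n (\<lambda>(i, j). U $$ (I ! i, j))" and ?W = "mat n n (\<lambda>(i, j). W $$ (i, J ! j))"
  have len: "length I = n" "length J = n" using assms(3,4) by (auto simp: inc_tuples_def)
  have bnd: "I ! i < m" "J ! i < q" if "i < n" for i
    using assms(3,4) that by (auto intro: inc_tuples_nth_less)
  have "u_fun n I U * xi_fun n J W = det (?U * ?W)"
    unfolding u_fun_def xi_fun_def by (rule det_mult[symmetric, of _ n]) auto
  also have "?U * ?W = mat n n (\<lambda>(i, j). row U (I ! i) \<bullet> col W (J ! j))"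
    using assms(1,2) bnd by (intro eq_matI) (auto simp: scalar_prod_def)
  finally show ?thesis by (simp add: p_fun_def len)
qed

lemma straightens_R1:
  assumes "0 < n" "I \<in> Hu n m" "J \<in> Hxi n q"
  shows "straightens n m q (EU I) (EXi J) [(1 :: 'k::field, EP (I, J), EZero)]"
proof -
  have "(I, J) \<in> Hp n m q" using assms by (auto simp: Hp_def Hu_def Hxi_def)
  then show ?thesis
    using assms u_fun_mult_xi_fun[of _ m n _ q I J]
    by (auto simp: straightens_def Dset_def Hu_def Hxi_def)
qed

text \<open>
All terms of a relation carry the same factor \<open>s * t\<close>, so the relation between the functions on \<open>X\<close>
carries over to the rescaled values.
\<close>

lemma sum_list_point_values:
  assumes "\<And>c i j. (c, i, j) \<in> set ts \<Longrightarrow> f (g i) = s * \<alpha> i \<and> f (h j) = t * (\<beta> j :: 'k::field)"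
  shows "(\<Sum>(c, z, w)\<leftarrow>map (\<lambda>(c, i, j). (c, g i, h j)) ts. c * f z * f w) =
    s * t * (\<Sum>(c, i, j)\<leftarrow>ts. c * \<alpha> i * \<beta> j)"
  using assms
proof (induction ts)
  case (Cons x ts)
  obtain c i j where x: "x = (c, i, j)" by (cases x)
  have "f (g i) = s * \<alpha> i" "f (h j) = t * \<beta> j"
    using Cons.prems[of c i j] x by auto
  moreover have "(\<Sum>(c, z, w)\<leftarrow>map (\<lambda>(c, i, j). (c, g i, h j)) ts. c * f z * f w) =
    s * t * (\<Sum>(c, i, j)\<leftarrow>ts. c * \<alpha> i * \<beta> j)"
    using Cons.prems by (intro Cons.IH) (metis list.set_intros(2))
  ultimately have "(\<Sum>(c, z, w)\<leftarrow>map (\<lambda>(c, i, j). (c, g i, h j)) (x # ts). c * f z * f w) =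
    c * (s * \<alpha> i) * (t * \<beta> j) + s * t * (\<Sum>(c, i, j)\<leftarrow>ts. c * \<alpha> i * \<beta> j)"
    using x by simp
  also have "\<dots> = s * t * (\<Sum>(c, i, j)\<leftarrow>x # ts. c * \<alpha> i * \<beta> j)"
    using x by (simp add: distrib_left ac_simps)
  finally show ?case .
qed simp

lemma straightens_R2:
  assumes "(I, I') \<in> noncomp tuple_ge (Hu n m)" "rel_R2 n m I I' ts"
  shows "straightens n m q (EU I) (EU I') (map (\<lambda>(c, i, j). (c, EU i, EU j)) ts)"
proof -
  have "EU I1 \<in> Dset n m q \<and> EU I2 \<in> Dset n m q \<and> D_ge (EU I1) (EU I) \<and>
      D_ge (EU I1) (EU I') \<and> D_ge (EU I) (EU I2) \<and> D_ge (EU I') (EU I2)"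
    if "(c, I1, I2) \<in> set ts" for c I1 I2
    using assms(2) that by (auto simp: rel_R2_def Dset_def)
  moreover have "EU I \<in> Dset n m q" "EU I' \<in> Dset n m q"
    using assms(1) by (auto simp: noncomp_def Dset_def)
  moreover have "point_value n U W t s (EU I) * point_value n U W t s (EU I') =
      (\<Sum>(c, z, w)\<leftarrow>map (\<lambda>(c, i, j). (c, EU i, EU j)) ts.
         c * point_value n U W t s z * point_value n U W t s w)"
    if "U \<in> carrier_mat m n" "W \<in> carrier_mat n q" for U W t s
    by (subst sum_list_point_values[of _ _ EU s "\<lambda>I. u_fun n I U" EU s "\<lambda>I. u_fun n I U"])
       (use assms(2) that in \<open>auto simp: rel_R2_def\<close>)
  ultimately show ?thesis
    unfolding straightens_def by auto
qed

lemma straightens_R3: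
  assumes "(J, J') \<in> noncomp tuple_ge (Hxi n q)" "rel_R3 n q J J' ts"
  shows "straightens n m q (EXi J) (EXi J') (map (\<lambda>(c, i, j). (c, EXi i, EXi j)) ts)"
proof -
  have "EXi I1 \<in> Dset n m q \<and> EXi I2 \<in> Dset n m q \<and> D_ge (EXi I1) (EXi J) \<and>
      D_ge (EXi I1) (EXi J') \<and> D_ge (EXi J) (EXi I2) \<and> D_ge (EXi J') (EXi I2)"
    if "(c, I1, I2) \<in> set ts" for c I1 I2
    using assms(2) that by (auto simp: rel_R3_def Dset_def)
  moreover have "EXi J \<in> Dset n m q" "EXi J' \<in> Dset n m q"
    using assms(1) by (auto simp: noncomp_def Dset_def)
  moreover have "point_value n U W t s (EXi J) * point_value n U W t s (EXi J') =
      (\<Sum>(c, z, w)\<leftarrow>map (\<lambda>(c, i, j). (c, EXi i, EXi j)) ts.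
         c * point_value n U W t s z * point_value n U W t s w)"
    if "U \<in> carrier_mat m n" "W \<in> carrier_mat n q" for U W t s
    by (subst sum_list_point_values[of _ _ EXi t "\<lambda>I. xi_fun n I W" EXi t "\<lambda>I. xi_fun n I W"])
       (use assms(2) that in \<open>auto simp: rel_R3_def\<close>)
  ultimately show ?thesis
    unfolding straightens_def by auto
qed

text \<open>
The element of \<open>D\<close> whose variable replaces \<open>p(A, B)\<close>, including the convention that \<open>p(\<emptyset>, \<emptyset>) = 1\<close>
is replaced by \<open>X(1)\<close>. Its value is \<open>t p(A, B)\<close> in both cases.
\<close>

definition pair_delem :: "tuple \<times> tuple \<Rightarrow> delem" where
  "pair_delem P = (if P = ([], []) then EOne else EP P)"

lemma Var_pair_delem: "Var (pair_delem P) = X' P"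
  by (simp add: pair_delem_def X'_def)

lemma point_value_pair_delem: "point_value n U W t s (pair_delem P) = t * p_fun P U W"
  by (simp add: pair_delem_def)

lemma straightens_R4:
  assumes "(A, B) \<in> noncomp pair_ge (Hp n m q)" "rel_R4 n m q A B ts"
  shows "straightens n m q (EP A) (EP B) (map (\<lambda>(c, i, j). (c, pair_delem i, EP j)) ts)"
proof -
  have terms: "pair_delem C \<in> Dset n m q \<and> EP D \<in> Dset n m q \<and> D_ge (pair_delem C) (EP A) \<and>
      D_ge (pair_delem C) (EP B) \<and> D_ge (EP A) (EP D) \<and> D_ge (EP B) (EP D)"
    if "(c, C, D) \<in> set ts" for c C D
    using assms(2) that by (auto simp: rel_R4_def pair_delem_def Dset_def pair_ge_def)
  have "EP A \<in> Dset n m q" "EP B \<in> Dset n m q" using assms(1) by (auto simp: noncomp_def Dset_def)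
  moreover have "point_value n U W t s (EP A) * point_value n U W t s (EP B) =
      (\<Sum>(c, z, w)\<leftarrow>map (\<lambda>(c, i, j). (c, pair_delem i, EP j)) ts.
         c * point_value n U W t s z * point_value n U W t s w)"
    if "U \<in> carrier_mat m n" "W \<in> carrier_mat n q" for U W t s
    by (subst sum_list_point_values[of _ _ pair_delem t "\<lambda>P. p_fun P U W" EP t "\<lambda>P. p_fun P U W"])
       (use assms(2) that in \<open>auto simp: rel_R4_def point_value_pair_delem\<close>)
  ultimately show ?thesis
    using terms unfolding straightens_def by auto
qed

lemma straightens_R5:
  assumes "P \<in> Hp n m q" "I \<in> Hu n m" "rel_R5 n m q P I ts"
  shows "straightens n m q (EP P) (EU I) (map (\<lambda>(c, i, j). (c, EP i, EU j)) ts)"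
proof -
  have "EP P1 \<in> Dset n m q \<and> EU I1 \<in> Dset n m q \<and> D_ge (EP P1) (EP P) \<and>
      D_ge (EP P1) (EU I) \<and> D_ge (EP P) (EU I1) \<and> D_ge (EU I) (EU I1)"
    if "(c, P1, I1) \<in> set ts" for c P1 I1
    using assms(3) that by (auto simp: rel_R5_def Dset_def pair_ge_def)
  moreover have "EP P \<in> Dset n m q" "EU I \<in> Dset n m q" using assms(1,2) by (auto simp: Dset_def)
  moreover have "point_value n U W t s (EP P) * point_value n U W t s (EU I) =
      (\<Sum>(c, z, w)\<leftarrow>map (\<lambda>(c, i, j). (c, EP i, EU j)) ts.
         c * point_value n U W t s z * point_value n U W t s w)"
    if "U \<in> carrier_mat m n" "W \<in> carrier_mat n q" for U W t s
    by (subst sum_list_point_values[of _ _ EP t "\<lambda>P. p_fun P U W" EU s "\<lambda>I. u_fun n I U"])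
       (use assms(3) that in \<open>auto simp: rel_R5_def\<close>)
  ultimately show ?thesis
    unfolding straightens_def by auto
qed

lemma straightens_R6:
  assumes "P \<in> Hp n m q" "J \<in> Hxi n q" "rel_R6 n m q P J ts"
  shows "straightens n m q (EP P) (EXi J) (map (\<lambda>(c, i, j). (c, EP i, EXi j)) ts)"
proof -
  have "EP P1 \<in> Dset n m q \<and> EXi I1 \<in> Dset n m q \<and> D_ge (EP P1) (EP P) \<and>
      D_ge (EP P1) (EXi J) \<and> D_ge (EP P) (EXi I1) \<and> D_ge (EXi J) (EXi I1)"
    if "(c, P1, I1) \<in> set ts" for c P1 I1
    using assms(3) that by (auto simp: rel_R6_def Dset_def pair_ge_def)
  moreover have "EP P \<in> Dset n m q" "EXi J \<in> Dset n m q" using assms(1,2) by (auto simp: Dset_def)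
  moreover have "point_value n U W t s (EP P) * point_value n U W t s (EXi J) =
      (\<Sum>(c, z, w)\<leftarrow>map (\<lambda>(c, i, j). (c, EP i, EXi j)) ts.
         c * point_value n U W t s z * point_value n U W t s w)"
    if "U \<in> carrier_mat m n" "W \<in> carrier_mat n q" for U W t s
    by (subst sum_list_point_values[of _ _ EP t "\<lambda>P. p_fun P U W" EXi t "\<lambda>I. xi_fun n I W"])
       (use assms(3) that in \<open>auto simp: rel_R6_def\<close>)
  ultimately show ?thesis
    unfolding straightens_def by auto
qed

lemma quadratic_form_map:
  "quadratic_form (map (\<lambda>(c, i, j). (c, g i, h j)) ts) = (\<Sum>(c, i, j)\<leftarrow>ts. Const c * Var (g i) * Var (h j))"
  unfolding quadratic_form_def by (induction ts) auto

lemma Const_one [simp]: "Const 1 = 1"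
  by (simp add: Const_def)

lemma D_relations_straighten:
  assumes "0 < n" "straightening_relations n m q S" "f \<in> D_relations n m q S"
  shows "\<exists>d e ts. straightens n m q d e ts \<and> f = Var d * Var e - quadratic_form ts"
proof -
  note st = assms(2)[unfolded straightening_relations_def]
  from assms(3) consider
      (R1) I J where "I \<in> Hu n m" "J \<in> Hxi n q" "f = Y I * Z J - X (I, J) * X_Zero"
    | (R2) I I' where "(I, I') \<in> noncomp tuple_ge (Hu n m)"
        "f = Y I * Y I' - (\<Sum>(b, I1, I2)\<leftarrow>st_uu S I I'. Const b * Y I1 * Y I2)"
    | (R3) J J' where "(J, J') \<in> noncomp tuple_ge (Hxi n q)"
        "f = Z J * Z J' - (\<Sum>(c, J1, J2)\<leftarrow>st_xixi S J J'. Const c * Z J1 * Z J2)"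
    | (R4) A B where "(A, B) \<in> noncomp pair_ge (Hp n m q)"
        "f = X A * X B - (\<Sum>(a, C, D)\<leftarrow>st_pp S A B. Const a * X' C * X D)"
    | (R5) P I where "P \<in> Hp n m q" "I \<in> Hu n m" "\<not> tuple_ge (fst P) I"
        "f = X P * Y I - (\<Sum>(d, P1, I1)\<leftarrow>st_pu S P I. Const d * X P1 * Y I1)"
    | (R6) P J where "P \<in> Hp n m q" "J \<in> Hxi n q" "\<not> tuple_ge (snd P) J"
        "f = X P * Z J - (\<Sum>(e, P1, J1)\<leftarrow>st_pxi S P J. Const e * X P1 * Z J1)"
    unfolding D_relations_def by blast
  then show ?thesis
  proof cases
    case R1
    then show ?thesis
      using straightens_R1[OF assms(1), of I m J q] by (force simp: quadratic_form_def)
  next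
    case R2
    with st have "rel_R2 n m I I' (st_uu S I I')" by blast
    from straightens_R2[OF R2(1) this] R2(2) show ?thesis by (metis quadratic_form_map)
  next
    case R3
    with st have "rel_R3 n q J J' (st_xixi S J J')" by blast
    from straightens_R3[OF R3(1) this] R3(2) show ?thesis by (metis quadratic_form_map)
  next
    case R4
    with st have "rel_R4 n m q A B (st_pp S A B)" by blast
    from straightens_R4[OF R4(1) this] R4(2) show ?thesis
      unfolding Var_pair_delem[symmetric] by (metis quadratic_form_map)
  next
    case R5
    with st have "rel_R5 n m q P I (st_pu S P I)" by blast
    from straightens_R5[OF R5(1,2) this] R5(4) show ?thesis by (metis quadratic_form_map)
  next
    case R6
    with st have "rel_R6 n m q P J (st_pxi S P J)" by blast
    from straightens_R6[OF R6(1,2) this] R6(4) show ?thesis by (metis quadratic_form_map)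
  qed
qed

text \<open>
Elements of \<open>D\<close> other than the top and the bottom are incomparable exactly in the situations listed in the
relations. The pair \<open>(d', e')\<close> allows for the order of the factors in the relation at hand.
\<close>

lemma incomparable_straighten:
  assumes "0 < n" "straightening_relations n m q S"
    and "d \<in> Dset n m q" "e \<in> Dset n m q" "\<not> D_ge d e" "\<not> D_ge e d"
  shows "\<exists>d' e' ts. {#d', e'#} = {#d, e#} \<and> straightens n m q d' e' ts \<and>
    Var d' * Var e' - quadratic_form ts \<in> D_relations n m q S"
proof -
  note st = assms(2)[unfolded straightening_relations_def]
  have R1: "\<exists>ts. straightens n m q (EU I) (EXi J) ts \<and>
      Var (EU I) * Var (EXi J) - quadratic_form ts \<in> D_relations n m q S"
    if "I \<in> Hu n m" "J \<in> Hxi n q" for I J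
    using straightens_R1[OF assms(1) that] that
    by (intro exI[of _ "[(1, EP (I, J), EZero)]"]) (auto simp: quadratic_form_def D_relations_def)
  have R2: "\<exists>ts. straightens n m q (EU I) (EU I') ts \<and>
      Var (EU I) * Var (EU I') - quadratic_form ts \<in> D_relations n m q S"
    if "(I, I') \<in> noncomp tuple_ge (Hu n m)" for I I'
  proof -
    have "rel_R2 n m I I' (st_uu S I I')" using st that by blast
    from straightens_R2[OF that this] that show ?thesis
      unfolding D_relations_def quadratic_form_map[symmetric] by blast
  qed
  have R3: "\<exists>ts. straightens n m q (EXi J) (EXi J') ts \<and>
      Var (EXi J) * Var (EXi J') - quadratic_form ts \<in> D_relations n m q S"
    if "(J, J') \<in> noncomp tuple_ge (Hxi n q)" for J J'
  proof -
    have "rel_R3 n q J J' (st_xixi S J J')" using st that by blast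
    from straightens_R3[OF that this] that show ?thesis
      unfolding D_relations_def quadratic_form_map[symmetric] by blast
  qed
  have R4: "\<exists>ts. straightens n m q (EP A) (EP B) ts \<and>
      Var (EP A) * Var (EP B) - quadratic_form ts \<in> D_relations n m q S"
    if "(A, B) \<in> noncomp pair_ge (Hp n m q)" for A B
  proof -
    have "rel_R4 n m q A B (st_pp S A B)" using st that by blast
    from straightens_R4[OF that this] that show ?thesis
      unfolding D_relations_def quadratic_form_map[symmetric] Var_pair_delem[symmetric] by blast
  qed
  have R5: "\<exists>ts. straightens n m q (EP P) (EU I) ts \<and>
      Var (EP P) * Var (EU I) - quadratic_form ts \<in> D_relations n m q S"
    if "P \<in> Hp n m q" "I \<in> Hu n m" "\<not> tuple_ge (fst P) I" for P I
  proof -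
    have "rel_R5 n m q P I (st_pu S P I)" using st that by blast
    from straightens_R5[OF that(1,2) this] that show ?thesis
      unfolding D_relations_def quadratic_form_map[symmetric] by blast
  qed
  have R6: "\<exists>ts. straightens n m q (EP P) (EXi J) ts \<and>
      Var (EP P) * Var (EXi J) - quadratic_form ts \<in> D_relations n m q S"
    if "P \<in> Hp n m q" "J \<in> Hxi n q" "\<not> tuple_ge (snd P) J" for P J
  proof -
    have "rel_R6 n m q P J (st_pxi S P J)" using st that by blast
    from straightens_R6[OF that(1,2) this] that show ?thesis
      unfolding D_relations_def quadratic_form_map[symmetric] by blast
  qed
  have thesis_if: "?thesis" if "\<exists>ts. straightens n m q d e ts \<and>
      Var d * Var e - quadratic_form ts \<in> D_relations n m q S"
    using that by blast
  have thesis_if_swapped: "?thesis" if "\<exists>ts. straightens n m q e d ts \<and>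
      Var e * Var d - quadratic_form ts \<in> D_relations n m q S"
    using that by (metis add_mset_commute)
  consider "d = EOne \<or> e = EOne \<or> d = EZero \<or> e = EZero"
    | P P' where "d = EP P" "e = EP P'" | P I where "d = EP P" "e = EU I" | P J where "d = EP P" "e = EXi J"
    | I P where "d = EU I" "e = EP P" | I I' where "d = EU I" "e = EU I'" | I J where "d = EU I" "e = EXi J"
    | J P where "d = EXi J" "e = EP P" | J I where "d = EXi J" "e = EU I" | J J' where "d = EXi J" "e = EXi J'"
    by (cases d; cases e) auto
  then show ?thesis
  proof cases
    case 1
    then show ?thesis using assms(5,6) by (cases d; cases e) auto
  next
    case 2 then show ?thesis using assms R4 by (intro thesis_if) (auto simp: noncomp_def Dset_def)
  next
    case 3 then show ?thesis using assms R5 by (intro thesis_if) (auto simp: Dset_def)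
  next
    case 4 then show ?thesis using assms R6 by (intro thesis_if) (auto simp: Dset_def)
  next
    case 5 then show ?thesis using assms R5 by (intro thesis_if_swapped) (auto simp: Dset_def)
  next
    case 6 then show ?thesis using assms R2 by (intro thesis_if) (auto simp: noncomp_def Dset_def)
  next
    case 7 then show ?thesis using assms R1 by (intro thesis_if) (auto simp: Dset_def)
  next
    case 8 then show ?thesis using assms R6 by (intro thesis_if_swapped) (auto simp: Dset_def)
  next
    case 9 then show ?thesis using assms R1 by (intro thesis_if_swapped) (auto simp: Dset_def)
  next
    case 10 then show ?thesis using assms R3 by (intro thesis_if) (auto simp: noncomp_def Dset_def)
  qed
qed

section \<open>Evaluation along the curve\<close>

text \<open>
The coordinates whose product is the diagonal monomial of the function attached to an element of \<open>D\<close>,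
together with its factor \<open>t\<close> or \<open>s\<close>.
\<close>

fun diagonal :: "delem \<Rightarrow> coord multiset" where
  "diagonal EOne = {#Tcoord#}"
| "diagonal EZero = {#Scoord#}"
| "diagonal (EP P) = {#Tcoord#} + image_mset (case_prod Ucoord) (mset (List.enumerate 0 (fst P)))
     + image_mset (case_prod Wcoord) (mset (List.enumerate 0 (snd P)))"
| "diagonal (EU I) = {#Scoord#} + image_mset (case_prod Ucoord) (mset (List.enumerate 0 I))"
| "diagonal (EXi J) = {#Tcoord#} + image_mset (case_prod Wcoord) (mset (List.enumerate 0 J))"

lemma sum_mset_enumerate:
  "(\<Sum>c\<in>#image_mset (case_prod C) (mset (List.enumerate 0 R)). g c) = (\<Sum>i = 0..<length R. g (C i (R ! i)) :: nat)"
proof -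
  have "(\<Sum>c\<in>#image_mset (case_prod C) (mset (List.enumerate 0 R)). g c) =
      (\<Sum>z\<leftarrow>List.enumerate 0 R. g (case_prod C z))"
    by (simp add: sum_mset_sum_list multiset.map_comp comp_def flip: mset_map)
  also have "\<dots> = (\<Sum>i = 0..<length R. g (C i (R ! i)))"
    by (simp add: sum_list_sum_nth nth_enumerate_eq)
  finally show ?thesis .
qed

text \<open>
The curve in \<open>X\<close> all of whose coordinates are powers of the parameter \<open>x\<close>.
\<close>

definition curve_U :: "nat \<Rightarrow> nat \<Rightarrow> nat \<Rightarrow> nat \<Rightarrow> 'k::field \<Rightarrow> 'k mat" where
  "curve_U N n M m x = mat m n (\<lambda>(a, i). x ^ coord_weight N n M (Ucoord i a))"

definition curve_W :: "nat \<Rightarrow> nat \<Rightarrow> nat \<Rightarrow> nat \<Rightarrow> 'k::field \<Rightarrow> 'k mat" where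
  "curve_W N n M q x = mat n q (\<lambda>(i, b). x ^ coord_weight N n M (Wcoord i b))"

lemma leading_degree_exists:
  fixes n m q N :: nat
  defines "M \<equiv> max m q"
  assumes "n < N" "d \<in> Dset n m q"
  shows "\<exists>Q :: 'k::field poly. Q \<noteq> 0 \<and> degree Q = (\<Sum>c\<in>#diagonal d. coord_weight N n M c) \<and>
    (\<forall>x. poly Q x = point_value n (curve_U N n M m x) (curve_W N n M q x)
       (x ^ coord_weight N n M Tcoord) (x ^ coord_weight N n M Scoord) d)"
proof -
  let ?w = "coord_weight N n M"
  note dom = dominating_coord_weight[OF \<open>n < N\<close>, of M]
  have sub: "inc_tuples r m \<subseteq> inc_tuples r M" "inc_tuples r q \<subseteq> inc_tuples r M" for r
    by (auto intro!: inc_tuples_mono simp: M_def)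
  have mult: "monom 1 k * Q \<noteq> 0 \<and> degree (monom 1 k * Q) = k + degree Q"
    if "Q \<noteq> 0" for k and Q :: "'k poly"
    using that by (simp add: degree_mult_eq degree_monom_eq)
  show ?thesis
  proof (cases d)
    case (EP P)
    obtain A B where P: "P = (A, B)" by (cases P)
    from assms(3) EP P obtain r where r: "r \<le> n" "A \<in> inc_tuples r m" "B \<in> inc_tuples r q"
      by (auto simp: Dset_def Hp_def)
    have len: "length A = r" "length B = r" using r by (auto simp: inc_tuples_def)
    obtain Q :: "'k poly" where Q: "Q \<noteq> 0"
      "degree Q = (\<Sum>i = 0..<r. ?w (Ucoord i (A ! i))) + (\<Sum>i = 0..<r. ?w (Wcoord i (B ! i)))"
      "\<And>x. poly Q x = det (mat r r (\<lambda>(i, j). \<Sum>k = 0..<n. x ^ ?w (Ucoord k (A ! i)) * x ^ ?w (Wcoord k (B ! j))))"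
      using product_minor_leading_degree[OF dom subsetD[OF sub(1) r(2)] subsetD[OF sub(2) r(3)] r(1)] by blast
    have "p_fun P (curve_U N n M m x) (curve_W N n M q x) = poly Q x" for x
      unfolding Q(3) p_fun_def P fst_conv snd_conv len
      using inc_tuples_nth_less[OF r(2)] inc_tuples_nth_less[OF r(3)]
      by (intro arg_cong[of _ _ det] cong_mat) (auto simp: curve_U_def curve_W_def scalar_prod_def)
    then show ?thesis using mult[OF Q(1), of "?w Tcoord"]
      by (intro exI[of _ "monom 1 (?w Tcoord) * Q"])
         (simp add: EP P Q(2) poly_monom sum_mset_enumerate len)
  next
    case (EU I)
    with assms(3) have I: "I \<in> inc_tuples n m" by (auto simp: Dset_def Hu_def)
    then have len: "length I = n" by (auto simp: inc_tuples_def)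
    obtain Q :: "'k poly" where Q: "Q \<noteq> 0" "degree Q = (\<Sum>i = 0..<n. ?w (Ucoord i (I ! i)))"
      "\<And>x. poly Q x = det (mat n n (\<lambda>(i, j). x ^ ?w (Ucoord j (I ! i))))"
      using minor_leading_degree[OF dom(1) subsetD[OF sub(1) I]] by blast
    have "u_fun n I (curve_U N n M m x) = poly Q x" for x
      unfolding Q(3) u_fun_def using inc_tuples_nth_less[OF I]
      by (intro arg_cong[of _ _ det] cong_mat) (auto simp: curve_U_def)
    then show ?thesis using mult[OF Q(1), of "?w Scoord"]
      by (intro exI[of _ "monom 1 (?w Scoord) * Q"])
         (simp add: EU Q(2) poly_monom sum_mset_enumerate len)
  next
    case (EXi J)
    with assms(3) have J: "J \<in> inc_tuples n q" by (auto simp: Dset_def Hxi_def)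
    then have len: "length J = n" by (auto simp: inc_tuples_def)
    obtain Q :: "'k poly" where Q: "Q \<noteq> 0" "degree Q = (\<Sum>i = 0..<n. ?w (Wcoord i (J ! i)))"
      "\<And>x. poly Q x = det (mat n n (\<lambda>(i, j). x ^ ?w (Wcoord j (J ! i))))"
      using minor_leading_degree[OF dom(2) subsetD[OF sub(2) J]] by blast
    (* transposing makes J the list of rows, as for the minors of U *)
    have "xi_fun n J (curve_W N n M q x) = poly Q x" for x
    proof -
      let ?A = "mat n n (\<lambda>(i, j). curve_W N n M q x $$ (i, J ! j))"
      have "xi_fun n J (curve_W N n M q x) = det (transpose_mat ?A)"
        unfolding xi_fun_def by (rule det_transpose[symmetric]) auto
      also have "transpose_mat ?A = mat n n (\<lambda>(i, j). x ^ ?w (Wcoord j (J ! i)))"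
        using inc_tuples_nth_less[OF J] by (intro eq_matI) (auto simp: curve_W_def)
      finally show ?thesis unfolding Q(3) .
    qed
    then show ?thesis using mult[OF Q(1), of "?w Tcoord"]
      by (intro exI[of _ "monom 1 (?w Tcoord) * Q"])
         (simp add: EXi Q(2) poly_monom sum_mset_enumerate len)
  next
    case EOne
    then show ?thesis
      by (intro exI[of _ "monom 1 (?w Tcoord)"]) (simp add: degree_monom_eq poly_monom)
  next
    case EZero
    then show ?thesis
      by (intro exI[of _ "monom 1 (?w Scoord)"]) (simp add: degree_monom_eq poly_monom)
  qed
qed

text \<open>
Over a finite field the polynomial that is 1 plus the product of all \<open>X - a\<close> has no root.
\<close>

lemma infinite_UNIV_alg_closed: "infinite (UNIV :: 'k::alg_closed_field set)"
proof
  assume fin: "finite (UNIV :: 'k set)"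
  let ?p = "(\<Prod>a\<in>UNIV. [:- a, 1:]) + 1 :: 'k poly"
  have "degree (\<Prod>a\<in>(UNIV :: 'k set). [:- a, 1:]) = card (UNIV :: 'k set)"
    by (subst degree_prod_eq_sum_degree) auto
  then have "degree ?p = card (UNIV :: 'k set)"
    using fin by (subst degree_add_eq_left) (auto simp: card_gt_0_iff)
  then have "degree ?p > 0" using fin by (simp add: card_gt_0_iff)
  then obtain x where "poly ?p x = 0" using alg_closed_imp_poly_has_root by blast
  moreover have "poly (\<Prod>a\<in>(UNIV :: 'k set). [:- a, 1:]) x = 0"
    using fin by (auto simp: poly_prod intro!: prod_zero exI[of _ x])
  ultimately show False by simp
qed

lemma poly_eq_0_if_vanishing:
  fixes p :: "'k::alg_closed_field poly"
  assumes "\<And>x. poly p x = 0"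
  shows "p = 0"
  using poly_roots_finite[of p] assms infinite_UNIV_alg_closed by auto

lemma poly_subst_relation_eq_0:
  fixes v :: "delem \<Rightarrow> 'k::alg_closed_field poly"
  assumes "straightens n m q d e ts"
    and U: "\<And>x. U x \<in> carrier_mat m n" and W: "\<And>x. W x \<in> carrier_mat n q"
    and v: "\<And>d x. d \<in> Dset n m q \<Longrightarrow> poly (v d) x = point_value n (U x) (W x) (t x) (s x) d"
  shows "poly_subst v (Var d * Var e - quadratic_form ts) = 0"
proof (rule poly_eq_0_if_vanishing)
  fix x
  note st = assms(1)[unfolded straightens_def]
  have "poly (poly_subst v (quadratic_form ts)) x =
      (\<Sum>(c, z, w)\<leftarrow>ts. c * point_value n (U x) (W x) (t x) (s x) z * point_value n (U x) (W x) (t x) (s x) w)"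
    if "\<forall>(c, z, w)\<in>set ts. z \<in> Dset n m q \<and> w \<in> Dset n m q"
    using that unfolding quadratic_form_def
    by (induction ts) (auto simp: poly_subst_add poly_subst_mult v)
  moreover have "\<forall>(c, z, w)\<in>set ts. z \<in> Dset n m q \<and> w \<in> Dset n m q" using st by fast
  moreover have "poly (v d) x * poly (v e) x =
      (\<Sum>(c, z, w)\<leftarrow>ts. c * point_value n (U x) (W x) (t x) (s x) z * point_value n (U x) (W x) (t x) (s x) w)"
    using st U[of x] W[of x] v by simp
  ultimately show "poly (poly_subst v (Var d * Var e - quadratic_form ts)) x = 0"
    by (simp add: poly_subst_diff poly_subst_mult)
qed

section \<open>Standard monomials have distinct leading monomials\<close>

definition var_product :: "delem list \<Rightarrow> 'k::field dpoly" where
  "var_product ds = (\<Prod>d\<leftarrow>ds. Var d)"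

text \<open>
The factors of a standard monomial, in decreasing order. Allowing rows \<open>Is\<close> and \<open>Js\<close> at the same time
treats both kinds of standard monomials uniformly; in \<open>std_lists\<close> one of the two lists is empty.
\<close>

definition std_list :: "nat \<Rightarrow> (tuple \<times> tuple) list \<Rightarrow> tuple list \<Rightarrow> tuple list \<Rightarrow> nat \<Rightarrow> delem list" where
  "std_list a Ps Is Js b =
     replicate a EOne @ map EP Ps @ map EU Is @ map EXi Js @ replicate b EZero"

definition std_lists :: "nat \<Rightarrow> nat \<Rightarrow> nat \<Rightarrow> delem list set" where
  "std_lists n m q = {std_list a Ps Is Js b | a Ps Is Js b.
     set Ps \<subseteq> Hp n m q \<and> set Is \<subseteq> Hu n m \<and> set Js \<subseteq> Hxi n q \<and> (Is = [] \<or> Js = []) \<and>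
     sorted_wrt D_ge (map EP Ps @ map EU Is @ map EXi Js)}"

lemma var_product_std_list:
  "var_product (std_list a Ps Is Js b) =
     X_One ^ a * (\<Prod>P\<leftarrow>Ps. X P) * (\<Prod>I\<leftarrow>Is. Y I) * (\<Prod>J\<leftarrow>Js. Z J) * X_Zero ^ b"
  by (simp add: var_product_def std_list_def comp_def ac_simps)

lemma std_monomials_eq: "std_monomials n m q = var_product ` std_lists n m q"
proof (intro equalityI subsetI)
  fix f :: "'a dpoly" assume "f \<in> std_monomials n m q"
  then consider (u) a b Ps Is where "f = X_One ^ a * (\<Prod>P\<leftarrow>Ps. X P) * (\<Prod>I\<leftarrow>Is. Y I) * X_Zero ^ b"
      "set Ps \<subseteq> Hp n m q" "set Is \<subseteq> Hu n m" "sorted_wrt D_ge (map EP Ps @ map EU Is)"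
    | (xi) a b Ps Js where "f = X_One ^ a * (\<Prod>P\<leftarrow>Ps. X P) * (\<Prod>J\<leftarrow>Js. Z J) * X_Zero ^ b"
      "set Ps \<subseteq> Hp n m q" "set Js \<subseteq> Hxi n q" "sorted_wrt D_ge (map EP Ps @ map EXi Js)"
    unfolding std_monomials_def by blast
  then show "f \<in> var_product ` std_lists n m q"
  proof cases
    case u
    then show ?thesis
      by (intro image_eqI[of _ _ "std_list a Ps Is [] b"]) (auto simp: var_product_std_list std_lists_def intro!: exI)
  next
    case xi
    then show ?thesis
      by (intro image_eqI[of _ _ "std_list a Ps [] Js b"]) (auto simp: var_product_std_list std_lists_def intro!: exI)
  qed
next
  fix f :: "'a dpoly" assume "f \<in> var_product ` std_lists n m q"
  then obtain a Ps Is Js b where f: "f = var_product (std_list a Ps Is Js b)"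
    and H: "set Ps \<subseteq> Hp n m q" "set Is \<subseteq> Hu n m" "set Js \<subseteq> Hxi n q" "Is = [] \<or> Js = []"
     "sorted_wrt D_ge (map EP Ps @ map EU Is @ map EXi Js)"
    unfolding std_lists_def by blast
  show "f \<in> std_monomials n m q"
  proof (cases "Js = []")
    case True
    with f H have "f = X_One ^ a * (\<Prod>P\<leftarrow>Ps. X P) * (\<Prod>I\<leftarrow>Is. Y I) * X_Zero ^ b"
      "sorted_wrt D_ge (map EP Ps @ map EU Is)" by (simp_all add: var_product_std_list)
    with H(1,2) show ?thesis unfolding std_monomials_def by blast
  next
    case False
    with f H have "f = X_One ^ a * (\<Prod>P\<leftarrow>Ps. X P) * (\<Prod>J\<leftarrow>Js. Z J) * X_Zero ^ b"
      "sorted_wrt D_ge (map EP Ps @ map EXi Js)" by (simp_all add: var_product_std_list)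
    with H(1,3) show ?thesis unfolding std_monomials_def by blast
  qed
qed

definition list_diagonal :: "delem list \<Rightarrow> coord multiset" where
  "list_diagonal ds = (\<Sum>d\<leftarrow>ds. diagonal d)"

text \<open>
The rows of \<open>U\<close> that occur in a standard monomial form the tableau with rows \<open>A\<^sub>1, A\<^sub>2, \<dots>, I\<^sub>1, I\<^sub>2, \<dots>\<close>, and
the columns of \<open>W\<close> the one with rows \<open>B\<^sub>1, B\<^sub>2, \<dots>, J\<^sub>1, J\<^sub>2, \<dots>\<close>.
\<close>

lemma list_diagonal_std_list:
  "list_diagonal (std_list a Ps Is Js b) =
     replicate_mset (a + length Ps + length Js) Tcoord + replicate_mset (length Is + b) Scoord +
     image_mset (case_prod Ucoord) (tableau_mset (map fst Ps @ Is)) +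
     image_mset (case_prod Wcoord) (tableau_mset (map snd Ps @ Js))"
proof -
  have rep: "(\<Sum>d\<leftarrow>replicate k d. diagonal d) = repeat_mset k (diagonal d)" for k d
    by (induction k) auto
  have Ps: "(\<Sum>P\<leftarrow>Ps. diagonal (EP P)) = replicate_mset (length Ps) Tcoord +
      image_mset (case_prod Ucoord) (tableau_mset (map fst Ps)) + image_mset (case_prod Wcoord) (tableau_mset (map snd Ps))"
    by (induction Ps) simp_all
  have Is: "(\<Sum>I\<leftarrow>Is. diagonal (EU I)) = replicate_mset (length Is) Scoord +
      image_mset (case_prod Ucoord) (tableau_mset Is)"
    by (induction Is) simp_all
  have Js: "(\<Sum>J\<leftarrow>Js. diagonal (EXi J)) = replicate_mset (length Js) Tcoord +
      image_mset (case_prod Wcoord) (tableau_mset Js)"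
    by (induction Js) simp_all
  have r: "repeat_mset k {#x#} = replicate_mset k x" for k and x :: coord
    by (induction k) auto
  have ra: "replicate_mset (i + j) x = replicate_mset i x + replicate_mset j x" for i j and x :: coord
    by (rule multiset_eqI) simp
  show ?thesis
    unfolding list_diagonal_def std_list_def map_append sum_list_append map_map comp_def rep
    unfolding Ps Is Js
    unfolding tableau_mset_simps image_mset_union diagonal.simps r ra
    by (simp only: ac_simps)
qed

fun is_Ucoord :: "coord \<Rightarrow> bool" where
  "is_Ucoord (Ucoord i a) = True" | "is_Ucoord _ = False"

fun is_Wcoord :: "coord \<Rightarrow> bool" where
  "is_Wcoord (Wcoord i b) = True" | "is_Wcoord _ = False"

lemma coord_part_simps:
  "filter_mset is_Ucoord (image_mset (case_prod Ucoord) M) = image_mset (case_prod Ucoord) M"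
  "filter_mset is_Ucoord (image_mset (case_prod Wcoord) M) = {#}"
  "filter_mset is_Wcoord (image_mset (case_prod Ucoord) M) = {#}"
  "filter_mset is_Wcoord (image_mset (case_prod Wcoord) M) = image_mset (case_prod Wcoord) M"
  "filter_mset is_Ucoord (replicate_mset k Tcoord) = {#}"
  "filter_mset is_Ucoord (replicate_mset k Scoord) = {#}"
  "filter_mset is_Wcoord (replicate_mset k Tcoord) = {#}"
  "filter_mset is_Wcoord (replicate_mset k Scoord) = {#}"
  "count (image_mset (case_prod Ucoord) M) Tcoord = 0"
  "count (image_mset (case_prod Ucoord) M) Scoord = 0"
  "count (image_mset (case_prod Wcoord) M) Tcoord = 0"
  "count (image_mset (case_prod Wcoord) M) Scoord = 0"
  by (induction M) auto

text \<open>
The two tableaux are determined by their columns. What is left is to locate, in each tableau, where the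
rows of the pairs \<open>(A\<^sub>k, B\<^sub>k)\<close> end: as \<open>Is\<close> or \<open>Js\<close> is empty, their number is the smaller of the numbers of
rows of the two tableaux. The exponents of \<open>t\<close> and \<open>s\<close> then give \<open>a\<close> and \<open>b\<close>.
\<close>

lemma std_list_inject:
  assumes "sorted_wrt tuple_ge (map fst Ps @ Is)" "sorted_wrt tuple_ge (map snd Ps @ Js)"
    "sorted_wrt tuple_ge (map fst Ps' @ Is')" "sorted_wrt tuple_ge (map snd Ps' @ Js')"
    "[] \<notin> set (map fst Ps @ Is)" "[] \<notin> set (map snd Ps @ Js)"
    "[] \<notin> set (map fst Ps' @ Is')" "[] \<notin> set (map snd Ps' @ Js')"
    "Is = [] \<or> Js = []" "Is' = [] \<or> Js' = []"
    "list_diagonal (std_list a Ps Is Js b) = list_diagonal (std_list a' Ps' Is' Js' b')"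
  shows "std_list a Ps Is Js b = std_list a' Ps' Is' Js' b'"
proof -
  have U: "filter_mset is_Ucoord (list_diagonal (std_list a Ps Is Js b)) =
      image_mset (case_prod Ucoord) (tableau_mset (map fst Ps @ Is))"
    and W: "filter_mset is_Wcoord (list_diagonal (std_list a Ps Is Js b)) =
      image_mset (case_prod Wcoord) (tableau_mset (map snd Ps @ Js))"
    and T: "count (list_diagonal (std_list a Ps Is Js b)) Tcoord = a + length Ps + length Js"
    and S: "count (list_diagonal (std_list a Ps Is Js b)) Scoord = length Is + b" for a Ps Is Js b
    unfolding list_diagonal_std_list filter_union_mset count_union coord_part_simps by simp_all
  have inj: "inj (image_mset (case_prod Ucoord))" "inj (image_mset (case_prod Wcoord))"
    by (rule multiset.inj_map, force simp: inj_def)+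
  have "tableau_mset (map fst Ps @ Is) = tableau_mset (map fst Ps' @ Is')"
    using U[of a Ps Is Js b] U[of a' Ps' Is' Js' b'] assms(11) inj(1) by (metis injD)
  then have R1: "map fst Ps @ Is = map fst Ps' @ Is'"
    by (intro tableau_mset_inject assms)
  have "tableau_mset (map snd Ps @ Js) = tableau_mset (map snd Ps' @ Js')"
    using W[of a Ps Is Js b] W[of a' Ps' Is' Js' b'] assms(11) inj(2) by (metis injD)
  then have R2: "map snd Ps @ Js = map snd Ps' @ Js'"
    by (intro tableau_mset_inject assms)
  have len: "length Ps + length Is = length Ps' + length Is'" "length Ps + length Js = length Ps' + length Js'"
    using arg_cong[OF R1, of length] arg_cong[OF R2, of length] by simp_all
  (* the number of pairs is the smaller of the numbers of rows of the two tableaux *)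
  have "length Ps = length Ps'" using len assms(9,10) by auto
  then have eqs: "map fst Ps = map fst Ps'" "map snd Ps = map snd Ps'" "Is = Is'" "Js = Js'"
    using R1 R2 by auto
  then have "Ps = Ps'" by (metis zip_map_fst_snd)
  moreover have "a = a'" "b = b'"
    using T[of a Ps Is Js b] T[of a' Ps' Is' Js' b'] S[of a Ps Is Js b] S[of a' Ps' Is' Js' b'] assms(11) eqs \<open>Ps = Ps'\<close>
    by auto
  ultimately show ?thesis using eqs by simp
qed

lemma inj_on_list_diagonal:
  assumes "0 < n"
  shows "inj_on list_diagonal (std_lists n m q)"
proof (rule inj_onI)
  have props: "sorted_wrt tuple_ge (map fst Ps @ Is)" "sorted_wrt tuple_ge (map snd Ps @ Js)"
    "[] \<notin> set (map fst Ps @ Is)" "[] \<notin> set (map snd Ps @ Js)"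
    if "set Ps \<subseteq> Hp n m q" "set Is \<subseteq> Hu n m" "set Js \<subseteq> Hxi n q"
      "sorted_wrt D_ge (map EP Ps @ map EU Is @ map EXi Js)" for Ps Is Js
  proof -
    have "sorted_wrt (\<lambda>P Q. pair_ge P Q) Ps" "sorted_wrt (\<lambda>I I'. tuple_ge I I') Is"
      "sorted_wrt (\<lambda>J J'. tuple_ge J J') Js"
      "\<forall>P\<in>set Ps. \<forall>I\<in>set Is. tuple_ge (fst P) I" "\<forall>P\<in>set Ps. \<forall>J\<in>set Js. tuple_ge (snd P) J"
      using that(4) by (auto simp: sorted_wrt_append sorted_wrt_map ball_Un)
    moreover from this(1) have "sorted_wrt (\<lambda>P Q. tuple_ge (fst P) (fst Q)) Ps"
      "sorted_wrt (\<lambda>P Q. tuple_ge (snd P) (snd Q)) Ps"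
      by (auto elim!: sorted_wrt_mono_rel[rotated] simp: pair_ge_def)
    ultimately show "sorted_wrt tuple_ge (map fst Ps @ Is)" "sorted_wrt tuple_ge (map snd Ps @ Js)"
      by (simp_all add: sorted_wrt_append sorted_wrt_map)
    show "[] \<notin> set (map fst Ps @ Is)" "[] \<notin> set (map snd Ps @ Js)"
      using that(1-3) assms by (force simp: Hp_def Hu_def Hxi_def inc_tuples_def)+
  qed
  fix xs ys assume "xs \<in> std_lists n m q" "ys \<in> std_lists n m q"
    and eq: "list_diagonal xs = list_diagonal ys"
  then obtain a Ps Is Js b a' Ps' Is' Js' b' where
    xs: "xs = std_list a Ps Is Js b" and ys: "ys = std_list a' Ps' Is' Js' b'"
    and H: "set Ps \<subseteq> Hp n m q" "set Is \<subseteq> Hu n m" "set Js \<subseteq> Hxi n q"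
      "sorted_wrt D_ge (map EP Ps @ map EU Is @ map EXi Js)"
    and H': "set Ps' \<subseteq> Hp n m q" "set Is' \<subseteq> Hu n m" "set Js' \<subseteq> Hxi n q"
      "sorted_wrt D_ge (map EP Ps' @ map EU Is' @ map EXi Js')"
    and emp: "Is = [] \<or> Js = []" "Is' = [] \<or> Js' = []"
    unfolding std_lists_def by blast
  show "xs = ys"
    unfolding xs ys
    by (rule std_list_inject[OF props(1,2)[OF H] props(1,2)[OF H'] props(3,4)[OF H] props(3,4)[OF H'] emp
          eq[unfolded xs ys]])
qed

section \<open>Linear independence after evaluation\<close>

lemma poly_lin_indep_if_distinct_degrees:
  fixes Q :: "'i \<Rightarrow> 'k::field poly"
  assumes "finite I" "\<And>i. i \<in> I \<Longrightarrow> Q i \<noteq> 0" "inj_on (\<lambda>i. degree (Q i)) I"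
    and "(\<Sum>i\<in>I. Polynomial.smult (c i) (Q i)) = 0"
  shows "\<forall>i\<in>I. c i = 0"
proof (rule ccontr)
  assume "\<not> (\<forall>i\<in>I. c i = 0)"
  then have ne: "{i \<in> I. c i \<noteq> 0} \<noteq> {}" by auto
  define A where "A = {i \<in> I. c i \<noteq> 0}"
  have "finite A" "A \<noteq> {}" using ne assms(1) by (auto simp: A_def)
  then obtain k where "k \<in> A" "degree (Q k) = Max ((\<lambda>i. degree (Q i)) ` A)"
    using Max_in[of "(\<lambda>i. degree (Q i)) ` A"] by fastforce
  then have k: "k \<in> I" "c k \<noteq> 0" and max: "\<And>i. i \<in> I \<Longrightarrow> c i \<noteq> 0 \<Longrightarrow> degree (Q i) \<le> degree (Q k)"
    using \<open>finite A\<close> by (auto simp: A_def)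
  have "c i * coeff (Q i) (degree (Q k)) = 0" if "i \<in> I - {k}" for i
    using max[of i] that k assms(3) by (cases "c i = 0") (auto simp: inj_on_def intro!: coeff_eq_0 le_neq_implies_less)
  then have "(\<Sum>i\<in>I - {k}. c i * coeff (Q i) (degree (Q k))) = 0" by (rule sum.neutral[OF ballI])
  then have "coeff (\<Sum>i\<in>I. Polynomial.smult (c i) (Q i)) (degree (Q k)) = c k * lead_coeff (Q k)"
    using k(1) assms(1) by (simp add: coeff_sum sum.remove[of I k])
  then show False using k assms(2)[of k] unfolding assms(4) by simp
qed

lemma diagonal_subset_coords:
  assumes "d \<in> Dset n m q"
  shows "set_mset (diagonal d) \<subseteq> coords n (max m q)"
proof -
  have rows: "case_prod Ucoord z \<in> coords n (max m q) \<and> case_prod Wcoord z \<in> coords n (max m q)"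
    if R: "R \<in> inc_tuples r k" "r \<le> n" "k \<le> max m q" and z: "z \<in> set (List.enumerate 0 R)" for R r k z
  proof -
    obtain i x where ix: "z = (i, x)" by (cases z)
    have "i < r" "x = R ! i" using R(1) z ix by (auto simp: in_set_enumerate_eq inc_tuples_def)
    then have "i < n" "x < max m q" using inc_tuples_nth_less[OF R(1)] R(2,3) by fastforce+
    then show ?thesis by (auto simp: ix coords_def)
  qed
  have TS: "Tcoord \<in> coords n (max m q)" "Scoord \<in> coords n (max m q)" by (auto simp: coords_def)
  show ?thesis
  proof (cases d)
    case (EP P)
    then obtain r where "fst P \<in> inc_tuples r m" "snd P \<in> inc_tuples r q" "r \<le> n"
      using assms by (auto simp: Dset_def Hp_def)
    then show ?thesis using rows[of "fst P" r m] rows[of "snd P" r q] TS EP by auto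
  next
    case (EU I)
    then have "I \<in> inc_tuples n m" using assms by (auto simp: Dset_def Hu_def)
    then show ?thesis using rows[of I n m] TS EU by auto
  next
    case (EXi J)
    then have "J \<in> inc_tuples n q" using assms by (auto simp: Dset_def Hxi_def)
    then show ?thesis using rows[of J n q] TS EXi by auto
  qed (use TS in auto)
qed

text \<open>
The degree of the image of a monomial, read in base \<open>N\<close>, determines its leading monomial.
\<close>

lemma list_diagonal_eq_if_weights_eq:
  assumes "set xs \<subseteq> Dset n m q" "set ys \<subseteq> Dset n m q"
    and "size (list_diagonal xs) < N" "size (list_diagonal ys) < N"
    and "(\<Sum>c\<in>#list_diagonal xs. coord_weight N n (max m q) c) = (\<Sum>c\<in>#list_diagonal ys. coord_weight N n (max m q) c)"
  shows "list_diagonal xs = list_diagonal ys"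
proof -
  let ?r = "coord_rank n (max m q)" and ?C = "coords n (max m q)"
  have sub: "set_mset (list_diagonal zs) \<subseteq> ?C" if "set zs \<subseteq> Dset n m q" for zs
    using that
  proof (induction zs)
    case (Cons z zs)
    then show ?case using diagonal_subset_coords[of z n m q] by (simp add: list_diagonal_def)
  qed (simp add: list_diagonal_def)
  have "image_mset ?r (list_diagonal xs) = image_mset ?r (list_diagonal ys)"
  proof (rule mset_power_sum_inject[of _ N])
    show "(\<Sum>p\<in>#image_mset ?r (list_diagonal xs). N ^ p) = (\<Sum>p\<in>#image_mset ?r (list_diagonal ys). N ^ p)"
      using assms(5) unfolding coord_weight_def by (simp add: multiset.map_comp comp_def)
  qed (use assms(3,4) in simp_all)
  then have "image_mset (the_inv_into ?C ?r) (image_mset ?r (list_diagonal xs)) =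
      image_mset (the_inv_into ?C ?r) (image_mset ?r (list_diagonal ys))" by simp
  moreover have "image_mset (the_inv_into ?C ?r) (image_mset ?r M) = M" if "set_mset M \<subseteq> ?C" for M
  proof -
    have "image_mset (the_inv_into ?C ?r) (image_mset ?r M) = image_mset id M"
      unfolding multiset.map_comp using that
      by (intro image_mset_cong) (auto simp: the_inv_into_f_f[OF inj_on_coord_rank])
    then show ?thesis by simp
  qed
  ultimately show ?thesis using sub assms(1,2) by simp
qed

lemma degree_poly_subst_var_product:
  assumes "set ds \<subseteq> Dset n m q"
    and "\<And>d. d \<in> Dset n m q \<Longrightarrow> v d \<noteq> 0 \<and> degree (v d) = (\<Sum>c\<in>#diagonal d. w c)"
  shows "poly_subst v (var_product ds) \<noteq> 0 \<and>
    degree (poly_subst v (var_product ds)) = (\<Sum>c\<in>#list_diagonal ds. w c)"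
  using assms(1)
  by (induction ds) (auto simp: var_product_def list_diagonal_def poly_subst_mult degree_mult_eq assms(2))

lemma std_lists_subset_Dset: "ds \<in> std_lists n m q \<Longrightarrow> set ds \<subseteq> Dset n m q"
proof -
  assume "ds \<in> std_lists n m q"
  then obtain a Ps Is Js b where "ds = std_list a Ps Is Js b"
    "set Ps \<subseteq> Hp n m q" "set Is \<subseteq> Hu n m" "set Js \<subseteq> Hxi n q"
    unfolding std_lists_def by blast
  moreover have "set (replicate k d) \<subseteq> {d}" for k and d :: delem by auto
  ultimately show "set ds \<subseteq> Dset n m q"
    by (simp add: std_list_def Dset_def) blast
qed

text \<open>
A combination in the ideal of relations is killed by every substitution that kills the relations. This is
applied to the evaluation along the curve, with a base \<open>N\<close> that exceeds the number of
coordinates in each leading monomial involved: the images of the standard monomials then have distinct degrees.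
\<close>

lemma std_lists_independent:
  fixes S :: "'k::alg_closed_field straightening"
  assumes "0 < n" "straightening_relations n m q S"
    and L: "finite L" "L \<subseteq> std_lists n m q"
    and vanish: "\<And>v :: delem \<Rightarrow> 'k poly. (\<And>f. f \<in> D_relations n m q S \<Longrightarrow> poly_subst v f = 0) \<Longrightarrow>
      poly_subst v (\<Sum>ds\<in>L. Const (c ds) * var_product ds) = 0"
  shows "\<forall>ds\<in>L. c ds = 0"
proof -
  define N where "N = n + (\<Sum>ds\<in>L. size (list_diagonal ds)) + 1"
  define M where "M = max m q"
  have "n < N" by (simp add: N_def)
  have size: "size (list_diagonal ds) < N" if "ds \<in> L" for ds
    using member_le_sum[OF that, of "\<lambda>ds. size (list_diagonal ds)"] L(1) by (simp add: N_def)
  let ?w = "coord_weight N n M"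
  (* v d is the value of d along the curve, as a polynomial in the parameter *)
  have "\<forall>d\<in>Dset n m q. \<exists>Q :: 'k poly. Q \<noteq> 0 \<and> degree Q = (\<Sum>c\<in>#diagonal d. ?w c) \<and>
      (\<forall>x. poly Q x = point_value n (curve_U N n M m x) (curve_W N n M q x) (x ^ ?w Tcoord) (x ^ ?w Scoord) d)"
    unfolding M_def by (intro ballI leading_degree_exists \<open>n < N\<close>)
  from bchoice[OF this] obtain v :: "delem \<Rightarrow> 'k poly" where v: "\<And>d. d \<in> Dset n m q \<Longrightarrow>
      v d \<noteq> 0 \<and> degree (v d) = (\<Sum>c\<in>#diagonal d. ?w c) \<and>
      (\<forall>x. poly (v d) x = point_value n (curve_U N n M m x) (curve_W N n M q x) (x ^ ?w Tcoord) (x ^ ?w Scoord) d)"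
    by blast
  have "poly_subst v f = 0" if f: "f \<in> D_relations n m q S" for f
  proof -
    obtain d e ts where st: "straightens n m q d e ts" "f = Var d * Var e - quadratic_form ts"
      using D_relations_straighten[OF assms(1,2) f] by blast
    show ?thesis unfolding st(2) using v
      by (intro poly_subst_relation_eq_0[OF st(1), of "curve_U N n M m" "curve_W N n M q"
            _ "\<lambda>x. x ^ ?w Tcoord" "\<lambda>x. x ^ ?w Scoord"]) (auto simp: curve_U_def curve_W_def)
  qed
  note van = vanish[OF this]
  have sub: "set ds \<subseteq> Dset n m q" if "ds \<in> L" for ds
    using that L(2) std_lists_subset_Dset by blast
  have deg: "poly_subst v (var_product ds) \<noteq> 0 \<and>
      degree (poly_subst v (var_product ds)) = (\<Sum>c\<in>#list_diagonal ds. ?w c)" if "ds \<in> L" for ds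
    using v by (intro degree_poly_subst_var_product[OF sub[OF that]]) blast
  show ?thesis
  proof (rule poly_lin_indep_if_distinct_degrees[of L "\<lambda>ds. poly_subst v (var_product ds)"])
    show "(\<Sum>ds\<in>L. Polynomial.smult (c ds) (poly_subst v (var_product ds))) = 0"
      using van by (simp add: poly_subst_sum poly_subst_mult)
    show "inj_on (\<lambda>ds. degree (poly_subst v (var_product ds))) L"
    proof (rule inj_onI)
      fix xs ys assume *: "xs \<in> L" "ys \<in> L" and
        "degree (poly_subst v (var_product xs)) = degree (poly_subst v (var_product ys))"
      then have "(\<Sum>c\<in>#list_diagonal xs. ?w c) = (\<Sum>c\<in>#list_diagonal ys. ?w c)"
        using deg[of xs] deg[of ys] by simp
      then have "list_diagonal xs = list_diagonal ys"
        unfolding M_def by (rule list_diagonal_eq_if_weights_eq[OF sub[OF *(1)] sub[OF *(2)] size[OF *(1)] size[OF *(2)]])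
      then show "xs = ys" using inj_on_list_diagonal[OF \<open>0 < n\<close>, of m q] * L(2) by (auto dest: inj_onD)
    qed
    show "poly_subst v (var_product ds) \<noteq> 0" if "ds \<in> L" for ds
      using deg[OF that] by blast
  qed (rule L(1))
qed

section \<open>Monomials with pairwise comparable factors\<close>

lemma D_ge_refl [simp]: "D_ge d d"
  by (cases d) (auto simp: pair_ge_def)

lemma D_ge_trans: "D_ge c d \<Longrightarrow> D_ge d e \<Longrightarrow> D_ge c e"
  by (cases c; cases d; cases e) (auto simp: pair_ge_def intro: tuple_ge_trans)

lemma finite_Dset: "finite (Dset n m q)"
proof -
  have "finite (inc_tuples r k)" for r k
  proof (rule finite_subset)
    show "inc_tuples r k \<subseteq> {xs. set xs \<subseteq> {..<k} \<and> length xs = r}" by (auto simp: inc_tuples_def)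
  qed (rule finite_lists_length_eq, simp)
  then show ?thesis by (auto simp: Dset_def Hp_def Hu_def Hxi_def)
qed

text \<open>
Counting the elements below turns the order of \<open>D\<close> into numbers; it serves to sort chains and to
measure progress of the straightening.
\<close>

definition height :: "nat \<Rightarrow> nat \<Rightarrow> nat \<Rightarrow> delem \<Rightarrow> nat" where
  "height n m q d = card {e \<in> Dset n m q. D_ge d e}"

lemma height_strict_mono:
  assumes "d \<in> Dset n m q" "D_ge d e" "\<not> D_ge e d"
  shows "height n m q e < height n m q d"
  unfolding height_def
  by (rule psubset_card_mono) (use assms finite_Dset D_ge_trans in \<open>auto intro: finite_subset\<close>)

fun the_EP :: "delem \<Rightarrow> (tuple \<times> tuple) option" where
  "the_EP (EP P) = Some P" | "the_EP _ = None"

fun the_EU :: "delem \<Rightarrow> tuple option" where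
  "the_EU (EU I) = Some I" | "the_EU _ = None"

fun the_EXi :: "delem \<Rightarrow> tuple option" where
  "the_EXi (EXi J) = Some J" | "the_EXi _ = None"

lemma map_filter_constructors:
  "map EP (List.map_filter the_EP ds) = filter (\<lambda>d. the_EP d \<noteq> None) ds"
  "map EU (List.map_filter the_EU ds) = filter (\<lambda>d. the_EU d \<noteq> None) ds"
  "map EXi (List.map_filter the_EXi ds) = filter (\<lambda>d. the_EXi d \<noteq> None) ds"
proof -
  have "EP P = d" if "the_EP d = Some P" for P d using that by (cases d) auto
  then show "map EP (List.map_filter the_EP ds) = filter (\<lambda>d. the_EP d \<noteq> None) ds"
    by (induction ds) (auto simp: List.map_filter_simps split: option.splits)
  have "EU I = d" if "the_EU d = Some I" for I d using that by (cases d) auto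
  then show "map EU (List.map_filter the_EU ds) = filter (\<lambda>d. the_EU d \<noteq> None) ds"
    by (induction ds) (auto simp: List.map_filter_simps split: option.splits)
  have "EXi J = d" if "the_EXi d = Some J" for J d using that by (cases d) auto
  then show "map EXi (List.map_filter the_EXi ds) = filter (\<lambda>d. the_EXi d \<noteq> None) ds"
    by (induction ds) (auto simp: List.map_filter_simps split: option.splits)
qed

lemma mset_std_list:
  "mset (std_list (count (mset ds) EOne) (List.map_filter the_EP ds) (List.map_filter the_EU ds)
     (List.map_filter the_EXi ds) (count (mset ds) EZero)) = mset ds"
proof (induction ds)
  case (Cons d ds)
  then show ?case by (cases d) (simp_all add: std_list_def List.map_filter_simps)
qed (simp add: std_list_def List.map_filter_simps)

lemma var_product_mset_cong: "mset ds = mset es \<Longrightarrow> var_product ds = var_product es"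
  unfolding var_product_def by (metis mset_map prod_mset_prod_list)

text \<open>
Sorting pairwise comparable factors by height arranges them in decreasing order. An element of \<open>H\<^sub>u\<close> and
one of \<open>H\<^sub>\<xi>\<close> are never comparable, so only one of the two kinds occurs, and it comes after the pairs.
\<close>

lemma var_product_chain:
  assumes "set ds \<subseteq> Dset n m q" "\<And>d e. d \<in> set ds \<Longrightarrow> e \<in> set ds \<Longrightarrow> D_ge d e \<or> D_ge e d"
  shows "(var_product ds :: 'k::field dpoly) \<in> std_monomials n m q"
proof -
  let ?h = "height n m q"
  define es where "es = rev (sort_key ?h ds)"
  have set: "set es = set ds" by (simp add: es_def)
  have "sorted_wrt (\<lambda>d e. ?h e \<le> ?h d) es"
    using sorted_sort_key[of ?h ds] by (simp add: es_def sorted_wrt_rev sorted_map)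
  then have sorted: "sorted_wrt D_ge es"
  proof (rule sorted_wrt_mono_rel[rotated])
    fix d e assume de: "d \<in> set es" "e \<in> set es" "?h e \<le> ?h d"
    show "D_ge d e"
    proof (rule ccontr)
      assume "\<not> D_ge d e"
      moreover have "D_ge d e \<or> D_ge e d" using assms(2) de unfolding set by blast
      moreover have "e \<in> Dset n m q" using assms(1) de unfolding set by blast
      ultimately have "?h d < ?h e" using height_strict_mono by blast
      then show False using de(3) by simp
    qed
  qed
  define Ps where "Ps = List.map_filter the_EP es"
  define Is where "Is = List.map_filter the_EU es"
  define Js where "Js = List.map_filter the_EXi es"
  have fil: "map EP Ps = filter (\<lambda>d. the_EP d \<noteq> None) es" "map EU Is = filter (\<lambda>d. the_EU d \<noteq> None) es"
    "map EXi Js = filter (\<lambda>d. the_EXi d \<noteq> None) es"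
    unfolding Ps_def Is_def Js_def by (rule map_filter_constructors)+
  have sub: "EP ` set Ps \<subseteq> set es" "EU ` set Is \<subseteq> set es" "EXi ` set Js \<subseteq> set es"
    using arg_cong[OF fil(1), of set] arg_cong[OF fil(2), of set] arg_cong[OF fil(3), of set] by auto
  have comp: "D_ge d e \<or> D_ge e d" if "d \<in> set es" "e \<in> set es" for d e
    using assms(2) that unfolding set .
  have elems: "P \<in> set Ps \<Longrightarrow> EP P \<in> set es" "I \<in> set Is \<Longrightarrow> EU I \<in> set es" "J \<in> set Js \<Longrightarrow> EXi J \<in> set es" for P I J
    using sub by blast+
  have cross: "D_ge (EP P) (EU I)" if "P \<in> set Ps" "I \<in> set Is" for P I
    using comp[OF elems(1)[OF that(1)] elems(2)[OF that(2)]] by simp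
  have cross': "D_ge (EP P) (EXi J)" if "P \<in> set Ps" "J \<in> set Js" for P J
    using comp[OF elems(1)[OF that(1)] elems(3)[OF that(2)]] by simp
  have no_mix: False if "I \<in> set Is" "J \<in> set Js" for I J
    using comp[OF elems(2)[OF that(1)] elems(3)[OF that(2)]] by simp
  have "Is = [] \<or> Js = []"
    using no_mix by (cases Is; cases Js) auto
  moreover have "sorted_wrt D_ge (map EP Ps @ map EU Is @ map EXi Js)"
    unfolding sorted_wrt_append
  proof (intro conjI ballI)
    show "sorted_wrt D_ge (map EP Ps)" "sorted_wrt D_ge (map EU Is)" "sorted_wrt D_ge (map EXi Js)"
      unfolding fil by (rule sorted_wrt_filter[OF sorted])+
    show "D_ge x y" if "x \<in> set (map EU Is)" "y \<in> set (map EXi Js)" for x y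
      using that no_mix by auto
    show "D_ge x y" if "x \<in> set (map EP Ps)" "y \<in> set (map EU Is @ map EXi Js)" for x y
      using that cross cross' unfolding set_append set_map by blast
  qed
  moreover have "set Ps \<subseteq> Hp n m q" "set Is \<subseteq> Hu n m" "set Js \<subseteq> Hxi n q"
    using sub assms(1) unfolding set Dset_def by blast+
  ultimately have "std_list (count (mset es) EOne) Ps Is Js (count (mset es) EZero) \<in> std_lists n m q"
    unfolding std_lists_def by blast
  moreover have "mset (std_list (count (mset es) EOne) Ps Is Js (count (mset es) EZero)) = mset ds"
    unfolding Ps_def Is_def Js_def mset_std_list by (simp add: es_def)
  ultimately show ?thesis
    unfolding std_monomials_eq by (metis var_product_mset_cong image_eqI)
qed

section \<open>The polynomial ring in the variables from D\<close>

lemma vars_zero [simp]: "vars 0 = {}"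
  by (simp add: vars_def)

lemma vars_add: "vars (f + g) \<subseteq> vars f \<union> vars g"
  unfolding vars_def using Poly_Mapping.keys_add[of f g] by blast

lemma vars_uminus [simp]: "vars (- f) = vars f"
  by (simp add: vars_def keys_def)

lemma vars_mult: "vars (f * g) \<subseteq> vars f \<union> vars g"
proof
  fix d assume "d \<in> vars (f * g)"
  then obtain e where "e \<in> Poly_Mapping.keys (f * g)" "d \<in> Poly_Mapping.keys e" by (auto simp: vars_def)
  then obtain a b where "a \<in> Poly_Mapping.keys f" "b \<in> Poly_Mapping.keys g" "d \<in> Poly_Mapping.keys (a + b)"
    using keys_mult[of f g] by blast
  then show "d \<in> vars f \<union> vars g" using Poly_Mapping.keys_add[of a b] by (auto simp: vars_def)
qed

lemma vars_add_subset: "vars f \<subseteq> V \<Longrightarrow> vars g \<subseteq> V \<Longrightarrow> vars (f + g) \<subseteq> V"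
  using vars_add[of f g] by blast

lemma vars_mult_subset: "vars f \<subseteq> V \<Longrightarrow> vars g \<subseteq> V \<Longrightarrow> vars (f * g) \<subseteq> V"
  using vars_mult[of f g] by blast

lemma vars_Const [simp]: "vars (Const c) = {}"
  by (auto simp: vars_def Const_def)

lemma vars_Var [simp]: "vars (Var d :: 'k::field dpoly) = {d}"
  by (simp add: vars_def Var_def)

lemma PD_simps [simp]:
  "carrier (PD n m q) = {f. vars f \<subseteq> Dset n m q}" "mult (PD n m q) = (*)" "one (PD n m q) = 1"
  "zero (PD n m q) = 0" "add (PD n m q) = (+)"
  by (simp_all add: PD_def)

lemma cring_PD: "cring (PD n m q :: 'k::field dpoly ring)"
proof (rule cringI)
  show "abelian_group (PD n m q :: 'k dpoly ring)"
  proof (rule abelian_groupI)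
    fix f :: "'k dpoly" assume "f \<in> carrier (PD n m q)"
    then show "\<exists>g\<in>carrier (PD n m q). g \<oplus>\<^bsub>PD n m q\<^esub> f = \<zero>\<^bsub>PD n m q\<^esub>"
      by (intro bexI[of _ "- f"]) auto
  qed (simp_all add: vars_add_subset add.assoc add.commute)
  have "vars (1 :: 'k dpoly) = {}" using vars_Const[of 1] by (simp del: vars_Const)
  then show "Group.comm_monoid (PD n m q :: 'k dpoly ring)"
    by (intro comm_monoidI) (simp_all add: vars_mult_subset mult.assoc mult.commute)
qed (simp add: distrib_right)

lemma vars_var_product: "vars (var_product ds :: 'k::field dpoly) \<subseteq> set ds"
proof (induction ds)
  case Nil
  show ?case using vars_Const[of "1::'k"] by (simp add: var_product_def del: vars_Const)
next
  case (Cons d ds)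
  then show ?case using vars_mult[of "Var d :: 'k dpoly" "var_product ds"] by (auto simp: var_product_def)
qed

lemma vars_quadratic_form:
  "vars (quadratic_form ts :: 'k::field dpoly) \<subseteq> (\<Union>(c, z, w)\<in>set ts. {z, w})"
proof (induction ts)
  case (Cons x ts)
  obtain c z w where x: "x = (c, z, w)" by (cases x)
  have "vars (Const c * Var z * Var w :: 'k dpoly) \<subseteq> {z, w}"
    using vars_mult[of "Const c * Var z" "Var w"] vars_mult[of "Const c" "Var z"] by auto
  moreover have "quadratic_form (x # ts) = Const c * Var z * Var w + (quadratic_form ts :: 'k dpoly)"
    by (simp add: quadratic_form_def x)
  ultimately show ?case
    using Cons vars_add[of "Const c * Var z * Var w" "quadratic_form ts"] x by fastforce
qed (simp add: quadratic_form_def)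

lemma single_eq_var_product:
  assumes "finite K"
  shows "\<exists>ds. set ds \<subseteq> K \<and>
    (Poly_Mapping.single (\<Sum>d\<in>K. Poly_Mapping.single d (g d)) 1 :: 'k::field dpoly) = var_product ds"
  using assms
proof (induction K)
  case empty
  show ?case by (intro exI[of _ "[]"]) (simp add: var_product_def)
next
  case (insert d K)
  then obtain ds where ds: "set ds \<subseteq> K"
    "(Poly_Mapping.single (\<Sum>d\<in>K. Poly_Mapping.single d (g d)) 1 :: 'k dpoly) = var_product ds" by blast
  have pow: "(Poly_Mapping.single (Poly_Mapping.single d k) 1 :: 'k dpoly) = var_product (replicate k d)" for k
  proof (induction k)
    case (Suc k)
    have "(Poly_Mapping.single (Poly_Mapping.single d (Suc k)) 1 :: 'k dpoly) =
        Var d * Poly_Mapping.single (Poly_Mapping.single d k) 1"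
      by (simp add: Var_def mult_single flip: single_add)
    then show ?case using Suc by (simp add: var_product_def)
  qed (simp add: var_product_def)
  have "(Poly_Mapping.single (\<Sum>d\<in>insert d K. Poly_Mapping.single d (g d)) 1 :: 'k dpoly) =
      Poly_Mapping.single (Poly_Mapping.single d (g d)) 1 *
      Poly_Mapping.single (\<Sum>d\<in>K. Poly_Mapping.single d (g d)) 1"
    using insert.hyps by (simp add: mult_single)
  also have "\<dots> = var_product (replicate (g d) d @ ds)"
    unfolding pow ds(2) by (simp add: var_product_def)
  finally show ?case using ds(1) by (intro exI[of _ "replicate (g d) d @ ds"]) auto
qed

section \<open>The algebra \<open>R(D)\<close> as a vector space\<close>

locale straightening_algebra =
  fixes n m q :: nat and S :: "'k::alg_closed_field straightening"
  assumes n_pos: "0 < n" and straight: "straightening_relations n m q S"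
begin

abbreviation "P \<equiv> PD n m q :: 'k dpoly ring"
abbreviation "I \<equiv> aD n m q S"
abbreviation "cls \<equiv> D_class n m q S"
abbreviation "R \<equiv> RD n m q S"
abbreviation "C \<equiv> carrier P"

sublocale P: cring P by (rule cring_PD)

lemma relations_subset: "D_relations n m q S \<subseteq> C"
proof
  fix f assume "f \<in> D_relations n m q S"
  from D_relations_straighten[OF n_pos straight this] obtain d e ts
    where st: "straightens n m q d e ts" "f = Var d * Var e - quadratic_form ts" by blast
  have "vars (quadratic_form ts) \<subseteq> Dset n m q"
    using st(1) vars_quadratic_form[of ts] unfolding straightens_def by fastforce
  moreover have "vars (Var d * Var e :: 'k dpoly) \<subseteq> Dset n m q"
    using st(1) vars_mult[of "Var d :: 'k dpoly" "Var e"] unfolding straightens_def by auto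
  ultimately show "f \<in> C"
    using vars_add[of "Var d * Var e" "- quadratic_form ts"] unfolding st(2) by auto
qed

sublocale I: ideal I P
  unfolding aD_def by (rule P.genideal_ideal[OF relations_subset])

lemma relations_in_I: "D_relations n m q S \<subseteq> I"
  unfolding aD_def by (rule P.genideal_self[OF relations_subset])

lemma C_closed:
  "f \<in> C \<Longrightarrow> g \<in> C \<Longrightarrow> f + g \<in> C" "f \<in> C \<Longrightarrow> g \<in> C \<Longrightarrow> f * g \<in> C"
  "f \<in> C \<Longrightarrow> g \<in> C \<Longrightarrow> f - g \<in> C" "Const c \<in> C" "d \<in> Dset n m q \<Longrightarrow> Var d \<in> C" "0 \<in> C"
  "set ds \<subseteq> Dset n m q \<Longrightarrow> var_product ds \<in> C"
  using P.a_closed[of f g] P.m_closed[of f g] vars_add[of f "- g"] vars_var_product[of ds] by auto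

lemma C_sum: "(\<And>i. i \<in> A \<Longrightarrow> f i \<in> C) \<Longrightarrow> (\<Sum>i\<in>A. f i) \<in> C"
  by (induction A rule: infinite_finite_induct) (auto simp del: PD_simps(1) intro!: C_closed)

declare PD_simps(1) [simp del]

sublocale Q: cring "P Quot I"
  by (rule I.quotient_is_cring[OF P.is_cring])

lemma cls_eq: "cls = a_r_coset P I"
  by (simp add: fun_eq_iff D_class_def)

lemma cls_hom: "cls \<in> Ring.ring_hom P (P Quot I)"
  unfolding cls_eq by (rule I.rcos_ring_hom)

lemma R_simps:
  "carrier R = carrier (P Quot I)" "add R = add (P Quot I)" "zero R = zero (P Quot I)"
  "smult R c x = cls (Const c) \<otimes>\<^bsub>P Quot I\<^esub> x"
  by (simp_all add: RD_def Let_def)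

lemma carrier_R: "carrier R = cls ` C"
  unfolding R_simps cls_eq by (auto simp: FactRing_def A_RCOSETS_def')

lemma cls_add: "f \<in> C \<Longrightarrow> g \<in> C \<Longrightarrow> cls (f + g) = cls f \<oplus>\<^bsub>R\<^esub> cls g"
  using ring_hom_add[OF cls_hom] by (simp add: R_simps)

lemma cls_mult: "f \<in> C \<Longrightarrow> g \<in> C \<Longrightarrow> cls (f * g) = cls f \<otimes>\<^bsub>P Quot I\<^esub> cls g"
  using ring_hom_mult[OF cls_hom] by simp

lemma cls_smult: "f \<in> C \<Longrightarrow> cls (Const c * f) = c \<odot>\<^bsub>R\<^esub> cls f"
  using cls_mult[OF C_closed(4)] by (simp add: R_simps)

lemma cls_eq_iff: "f \<in> C \<Longrightarrow> g \<in> C \<Longrightarrow> cls f = cls g \<longleftrightarrow> f - g \<in> I"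
proof -
  assume fg: "f \<in> C" "g \<in> C"
  have "\<ominus>\<^bsub>P\<^esub> g = - g" using fg C_closed(3)[of 0 g] C_closed(6) by (intro P.minus_equality) auto
  then have "f \<ominus>\<^bsub>P\<^esub> g = f - g" by (simp add: a_minus_def)
  then show ?thesis
    using P.quotient_eq_iff_same_a_r_cos[OF I.ideal_axioms fg] unfolding cls_eq by simp
qed

lemma cls_zero: "cls 0 = \<zero>\<^bsub>R\<^esub>"
  using ring_hom_zero[OF cls_hom P.ring_axioms Q.ring_axioms] by (simp add: R_simps)

text \<open>
The polynomials in \<open>P(D)\<close> killed by a substitution form an ideal, and the ideal of relations is the
smallest one that contains the relations.
\<close>

lemma I_subset_kernel:
  fixes v :: "delem \<Rightarrow> 'k poly"
  assumes "\<And>f. f \<in> D_relations n m q S \<Longrightarrow> poly_subst v f = 0" "f \<in> I"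
  shows "poly_subst v f = 0"
proof -
  have "ideal {f \<in> C. poly_subst v f = 0} P"
  proof (rule idealI)
    show "subgroup {f \<in> C. poly_subst v f = 0} (add_monoid P)"
    proof
      fix f assume f: "f \<in> {f \<in> C. poly_subst v f = 0}"
      have "inv\<^bsub>add_monoid P\<^esub> f = - f"
        using f C_closed(3)[of 0 f] C_closed(6) by (intro P.minus_equality[unfolded a_inv_def]) auto
      then show "inv\<^bsub>add_monoid P\<^esub> f \<in> {f \<in> C. poly_subst v f = 0}"
        using f poly_subst_diff[of v 0 f] C_closed(3)[of 0 f] C_closed(6) by auto
    qed (use C_closed in \<open>auto simp: poly_subst_add\<close>)
  qed (use C_closed in \<open>auto simp: poly_subst_mult P.ring_axioms\<close>)
  then have "I \<subseteq> {f \<in> C. poly_subst v f = 0}"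
    unfolding aD_def using assms(1) relations_subset by (intro P.genideal_minimal) auto
  then show ?thesis using assms(2) by blast
qed

lemma vectorspace_R: "vectorspace class_ring R"
proof -
  have "module class_ring R"
  proof (rule moduleI)
    show "cring (class_ring :: 'k ring)" by (rule class_cring.cring_axioms)
    show "abelian_group R"
    proof (rule abelian_groupI; unfold R_simps)
      fix x assume "x \<in> carrier (P Quot I)"
      then show "\<exists>y\<in>carrier (P Quot I). y \<oplus>\<^bsub>P Quot I\<^esub> x = \<zero>\<^bsub>P Quot I\<^esub>"
        by (intro bexI[of _ "\<ominus>\<^bsub>P Quot I\<^esub> x"]) (simp_all add: Q.l_neg)
    qed (simp_all add: Q.a_ac)
    fix a b :: 'k and x y
    assume x: "x \<in> carrier R"
    then obtain f where f: "f \<in> C" "x = cls f" unfolding carrier_R by blast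
    show "a \<odot>\<^bsub>R\<^esub> x \<in> carrier R"
      unfolding f(2) carrier_R using f(1) by (metis C_closed(2,4) cls_smult image_eqI)
    have "Const (a + b) * f = Const a * f + Const b * f"
      by (simp add: Const_def single_add distrib_right)
    then show "(a \<oplus>\<^bsub>class_ring\<^esub> b) \<odot>\<^bsub>R\<^esub> x = a \<odot>\<^bsub>R\<^esub> x \<oplus>\<^bsub>R\<^esub> b \<odot>\<^bsub>R\<^esub> x"
      unfolding f(2) using f(1) by (simp add: C_closed cls_add flip: cls_smult)
    have "Const (a * b) * f = Const a * (Const b * f)"
      by (simp add: Const_def mult_single flip: mult.assoc)
    then show "(a \<otimes>\<^bsub>class_ring\<^esub> b) \<odot>\<^bsub>R\<^esub> x = a \<odot>\<^bsub>R\<^esub> (b \<odot>\<^bsub>R\<^esub> x)"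
      unfolding f(2) using f(1) by (simp add: C_closed flip: cls_smult)
    show "\<one>\<^bsub>class_ring\<^esub> \<odot>\<^bsub>R\<^esub> x = x"
      unfolding f(2) using cls_smult[OF f(1), of 1] by simp
    assume "y \<in> carrier R"
    then obtain g where g: "g \<in> C" "y = cls g" unfolding carrier_R by blast
    have "Const a * (f + g) = Const a * f + Const a * g" by (rule distrib_left)
    then show "a \<odot>\<^bsub>R\<^esub> (x \<oplus>\<^bsub>R\<^esub> y) = a \<odot>\<^bsub>R\<^esub> x \<oplus>\<^bsub>R\<^esub> a \<odot>\<^bsub>R\<^esub> y"
      unfolding f(2) g(2) using f(1) g(1) by (simp add: C_closed flip: cls_smult cls_add)
  qed
  then show ?thesis by (intro vectorspace.intro class_field)
qed

sublocale V: vectorspace class_ring R by (rule vectorspace_R)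

lemma finsum_cls:
  assumes "finite L" "\<And>ds. ds \<in> L \<Longrightarrow> f ds \<in> C"
  shows "(\<Oplus>\<^bsub>R\<^esub>ds\<in>L. c ds \<odot>\<^bsub>R\<^esub> cls (f ds)) = cls (\<Sum>ds\<in>L. Const (c ds) * f ds)"
  using assms
proof (induction L)
  case (insert x L)
  have "(\<lambda>ds. c ds \<odot>\<^bsub>R\<^esub> cls (f ds)) \<in> insert x L \<rightarrow> carrier R"
    using insert.prems by (auto simp: carrier_R C_closed simp flip: cls_smult intro!: imageI)
  then have "(\<Oplus>\<^bsub>R\<^esub>ds\<in>insert x L. c ds \<odot>\<^bsub>R\<^esub> cls (f ds)) =
      c x \<odot>\<^bsub>R\<^esub> cls (f x) \<oplus>\<^bsub>R\<^esub> (\<Oplus>\<^bsub>R\<^esub>ds\<in>L. c ds \<odot>\<^bsub>R\<^esub> cls (f ds))"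
    using insert.hyps by (intro V.M.finsum_insert) auto
  also have "\<dots> = cls (Const (c x) * f x) \<oplus>\<^bsub>R\<^esub> cls (\<Sum>ds\<in>L. Const (c ds) * f ds)"
    using insert by (simp add: cls_smult)
  also have "\<dots> = cls (\<Sum>ds\<in>insert x L. Const (c ds) * f ds)"
    using insert.hyps insert.prems
    by (subst cls_add[symmetric]) (auto intro!: C_closed C_sum)
  finally show ?case .
qed (simp add: cls_zero)

section \<open>The standard monomials form a basis\<close>

lemma std_independent:
  assumes "finite L" "L \<subseteq> std_lists n m q" "(\<Sum>ds\<in>L. Const (c ds) * var_product ds) \<in> I"
  shows "\<forall>ds\<in>L. c ds = 0"
  by (rule std_lists_independent[OF n_pos straight assms(1,2)]) (rule I_subset_kernel[OF _ assms(3)])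

lemma std_list_in_C: "ds \<in> std_lists n m q \<Longrightarrow> var_product ds \<in> C"
  using std_lists_subset_Dset C_closed(7) by blast

text \<open>
Two different standard monomials with the same class would yield the relation with coefficients 1 and -1.
\<close>

lemma inj_on_cls_std: "inj_on (\<lambda>ds. cls (var_product ds)) (std_lists n m q)"
proof (rule inj_onI, rule ccontr)
  fix xs ys assume *: "xs \<in> std_lists n m q" "ys \<in> std_lists n m q"
    "cls (var_product xs) = cls (var_product ys)" "xs \<noteq> ys"
  have m1: "Const (- 1 :: 'k) = - 1" by (simp add: Const_def single_uminus)
  let ?c = "\<lambda>ds. if ds = xs then 1 else - 1 :: 'k"
  have "var_product xs - var_product ys \<in> I"
    using * cls_eq_iff[OF std_list_in_C std_list_in_C] by blast
  then have "(\<Sum>ds\<in>{xs, ys}. Const (?c ds) * var_product ds) \<in> I"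
    using *(4) by (simp add: m1)
  then have "?c xs = 0"
    using std_independent[of "{xs, ys}" ?c] * by blast
  then show False by simp
qed

lemma std_subset: "cls ` std_monomials n m q \<subseteq> carrier R"
  unfolding carrier_R std_monomials_eq using std_list_in_C by auto

lemma std_lin_indpt: "V.lin_indpt (cls ` std_monomials n m q)"
proof
  assume "V.lin_dep (cls ` std_monomials n m q)"
  then obtain A a v where A: "finite A" "A \<subseteq> cls ` std_monomials n m q"
    and zero: "V.lincomb a A = \<zero>\<^bsub>R\<^esub>" and v: "v \<in> A" "a v \<noteq> 0"
    unfolding V.lin_dep_def by auto
  have "A \<subseteq> (\<lambda>ds. cls (var_product ds)) ` std_lists n m q"
    using A(2) by (simp add: std_monomials_eq image_image)
  with A(1) obtain L where L: "L \<subseteq> std_lists n m q" "finite L" "A = (\<lambda>ds. cls (var_product ds)) ` L"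
    by (meson finite_subset_image)
  have LC: "var_product ds \<in> C" if "ds \<in> L" for ds using std_list_in_C that L(1) by blast
  let ?c = "\<lambda>ds. a (cls (var_product ds))"
  have closed: "(\<lambda>v. a v \<odot>\<^bsub>R\<^esub> v) \<in> A \<rightarrow> carrier R"
  proof
    fix v assume "v \<in> A"
    then have "v \<in> carrier R"
      using A(2) std_subset by blast
    then show "a v \<odot>\<^bsub>R\<^esub> v \<in> carrier R" by (intro V.smult_closed) simp_all
  qed
  have "V.lincomb a A = (\<Oplus>\<^bsub>R\<^esub>ds\<in>L. ?c ds \<odot>\<^bsub>R\<^esub> cls (var_product ds))"
    unfolding V.lincomb_def using closed L(1) inj_on_cls_std unfolding L(3)
    by (intro V.M.finsum_reindex) (auto intro: inj_on_subset)
  also have "\<dots> = cls (\<Sum>ds\<in>L. Const (?c ds) * var_product ds)"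
    using L(2) LC by (rule finsum_cls)
  finally have "cls (\<Sum>ds\<in>L. Const (?c ds) * var_product ds) = cls 0"
    using zero cls_zero by simp
  then have "(\<Sum>ds\<in>L. Const (?c ds) * var_product ds) \<in> I"
    using LC by (subst (asm) cls_eq_iff) (auto intro!: C_sum C_closed(2,4,6) LC)
  then have "\<forall>ds\<in>L. ?c ds = 0" by (rule std_independent[OF L(2,1)])
  then show False using v L(3) by auto
qed

abbreviation "Sp \<equiv> V.span (cls ` std_monomials n m q)"

lemma Sp_closed:
  "x \<in> Sp \<Longrightarrow> y \<in> Sp \<Longrightarrow> x \<oplus>\<^bsub>R\<^esub> y \<in> Sp" "x \<in> Sp \<Longrightarrow> c \<odot>\<^bsub>R\<^esub> x \<in> Sp" "cls 0 \<in> Sp"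
  "f \<in> std_monomials n m q \<Longrightarrow> cls f \<in> Sp"
proof -
  note sm = V.span_is_submodule[OF std_subset]
  show "x \<in> Sp \<Longrightarrow> y \<in> Sp \<Longrightarrow> x \<oplus>\<^bsub>R\<^esub> y \<in> Sp" by (rule submodule.m_closed[OF sm])
  show "x \<in> Sp \<Longrightarrow> c \<odot>\<^bsub>R\<^esub> x \<in> Sp" by (rule submodule.smult_closed[OF sm]) simp
  show "cls 0 \<in> Sp" unfolding cls_zero by (rule submodule.zero_closed[OF sm])
  show "f \<in> std_monomials n m q \<Longrightarrow> cls f \<in> Sp"
    using V.in_own_span[OF std_subset] by blast
qed

text \<open>
Straightening terminates: replacing \<open>d e\<close> by \<open>z w\<close> with \<open>z\<close> strictly above \<open>d\<close> and \<open>e\<close> increases the sum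
of the \<open>2 ^ h\<close>, since \<open>2 ^ h z\<close> alone is at least \<open>2 ^ h d + 2 ^ h e\<close>. The number of factors stays the
same, which bounds the sum.
\<close>

lemma cls_var_product_in_span:
  assumes "set ds \<subseteq> Dset n m q"
  shows "cls (var_product ds) \<in> Sp"
  using assms
proof (induction ds rule: measure_induct_rule[where f = "\<lambda>ds. length ds * 2 ^ card (Dset n m q) -
    (\<Sum>d\<leftarrow>ds. 2 ^ height n m q d)"])
  case (less ds)
  let ?h = "height n m q"
  let ?\<Phi> = "\<lambda>ds. \<Sum>d\<leftarrow>ds. (2::nat) ^ ?h d"
  show ?case
  proof (cases "\<forall>d\<in>set ds. \<forall>e\<in>set ds. D_ge d e \<or> D_ge e d")
    case True
    then show ?thesis using less.prems by (intro Sp_closed(4) var_product_chain) blast+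
  next
    case False
    then obtain d0 e0 where de0: "d0 \<in> set ds" "e0 \<in> set ds" "\<not> D_ge d0 e0" "\<not> D_ge e0 d0" by blast
    then have "d0 \<in> Dset n m q" "e0 \<in> Dset n m q" using less.prems by auto
    from incomparable_straighten[OF n_pos straight this de0(3,4)] obtain d e ts where
      de: "{#d, e#} = {#d0, e0#}" and st: "straightens n m q d e ts"
      and rel: "Var d * Var e - quadratic_form ts \<in> D_relations n m q S" by blast
    have inc: "\<not> D_ge d e" "\<not> D_ge e d"
      using de de0(3,4) by (auto simp: add_eq_conv_ex)
    define ds' where "ds' = remove1 d0 ds"
    define rest where "rest = remove1 e0 ds'"
    have "d0 \<noteq> e0" using de0(3) by auto
    then have "e0 \<in> set ds'" using de0(2) by (simp add: ds'_def)
    then have "mset ds' = add_mset e0 (mset rest)" by (simp add: rest_def)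
    moreover have "mset ds = add_mset d0 (mset ds')" using de0(1) by (simp add: ds'_def)
    ultimately have "mset ds = {#d0, e0#} + mset rest" by simp
    then have ms: "mset ds = mset (d # e # rest)" using de by (metis mset.simps add_mset_add_single union_mset_add_mset_left union_mset_add_mset_right add_0)
    then have rest: "set rest \<subseteq> Dset n m q" using less.prems by (metis mset_eq_setD set_subset_Cons subset_trans)
    have \<Phi>: "?\<Phi> ds = 2 ^ ?h d + 2 ^ ?h e + ?\<Phi> rest" and len: "length ds = length rest + 2"
      using arg_cong[OF ms, of "\<lambda>M. \<Sum>d\<in>#M. (2::nat) ^ ?h d"] arg_cong[OF ms, of size]
      by (simp_all add: sum_mset_sum_list flip: mset_map)
    have summand: "cls (var_product (z # w # rest)) \<in> Sp" if "(c, z, w) \<in> set ts" for c z w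
    proof (rule less.IH)
      have zw: "z \<in> Dset n m q" "w \<in> Dset n m q" "D_ge z d" "D_ge z e" 
        using st that unfolding straightens_def by fast+
      then show "set (z # w # rest) \<subseteq> Dset n m q" using rest by simp
      (* z is strictly above d and e: otherwise d and e would be comparable via z *)
      have "\<not> D_ge d z" "\<not> D_ge e z" using inc zw D_ge_trans by blast+
      then have "?h d < ?h z" "?h e < ?h z" using zw height_strict_mono by blast+
      then have "2 ^ Suc (?h d) \<le> (2::nat) ^ ?h z" "2 ^ Suc (?h e) \<le> (2::nat) ^ ?h z"
        by (intro power_increasing; simp)+
      moreover have "0 < (2::nat) ^ ?h w" by simp
      ultimately have lt: "?\<Phi> ds < ?\<Phi> (z # w # rest)"
        unfolding \<Phi> list.map sum_list.Cons power_Suc by linarith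
      have bound: "?\<Phi> es \<le> length es * 2 ^ card (Dset n m q)" for es
      proof (induction es)
        case (Cons x es)
        have "?h x \<le> card (Dset n m q)"
          unfolding height_def by (intro card_mono finite_Dset) auto
        then have "(2::nat) ^ ?h x \<le> 2 ^ card (Dset n m q)" by (intro power_increasing) auto
        from add_mono[OF this Cons] show ?case by simp
      qed simp
      show "length (z # w # rest) * 2 ^ card (Dset n m q) - ?\<Phi> (z # w # rest) <
          length ds * 2 ^ card (Dset n m q) - ?\<Phi> ds"
        using lt bound[of "z # w # rest"] len by simp
    qed
    have sum: "quadratic_form us * var_product rest \<in> C \<and> cls (quadratic_form us * var_product rest) \<in> Sp"
      if "set us \<subseteq> set ts" for us
      using that
    proof (induction us)
      case Nil
      then show ?case using C_closed(6) Sp_closed(3) by (simp add: quadratic_form_def)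
    next
      case (Cons u us)
      obtain c z w where u: "u = (c, z, w)" by (cases u)
      have mem: "(c, z, w) \<in> set ts" using Cons.prems u by simp
      have zw: "var_product (z # w # rest) \<in> C"
        using st mem rest by (intro C_closed(7)) (auto simp: straightens_def)
      have IH: "quadratic_form us * var_product rest \<in> C" "cls (quadratic_form us * var_product rest) \<in> Sp"
        using Cons by auto
      have eq: "quadratic_form (u # us) * var_product rest =
          Const c * var_product (z # w # rest) + quadratic_form us * var_product rest"
        by (simp add: quadratic_form_def u var_product_def algebra_simps)
      have C1: "Const c * var_product (z # w # rest) \<in> C" using zw by (intro C_closed(2,4))
      then show ?case
        unfolding eq cls_add[OF C1 IH(1)] cls_smult[OF zw]
        using IH summand[OF mem] by (intro conjI C_closed(1) Sp_closed(1,2)) auto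
    qed
    have "var_product ds = var_product (d # e # rest)" by (rule var_product_mset_cong[OF ms])
    then have "var_product ds - quadratic_form ts * var_product rest =
        (Var d * Var e - quadratic_form ts) * (var_product rest :: 'k dpoly)"
      by (simp add: var_product_def algebra_simps)
    moreover have "(Var d * Var e - quadratic_form ts) * var_product rest \<in> I"
      using I.I_r_closed[of "Var d * Var e - quadratic_form ts" "var_product rest"] rel relations_in_I
        C_closed(7)[OF rest] by auto
    ultimately have "cls (var_product ds) = cls (quadratic_form ts * var_product rest)"
      using sum[of ts] C_closed(7)[OF less.prems] by (subst cls_eq_iff) auto
    then show ?thesis using sum[of ts] by simp
  qed
qed

text \<open>
A polynomial is a combination of monomials, each of which is a product of variables from \<open>D\<close>.
\<close>

lemma std_spans: "Sp = carrier R"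
proof
  show "Sp \<subseteq> carrier R" using V.span_is_subset2[OF std_subset] .
  show "carrier R \<subseteq> Sp"
  proof
    fix x assume "x \<in> carrier R"
    then obtain f where f: "f \<in> C" "x = cls f" unfolding carrier_R by blast
    let ?t = "\<lambda>e. Poly_Mapping.single e (Poly_Mapping.lookup f e)"
    have mono: "?t e \<in> C \<and> cls (?t e) \<in> Sp" if e: "e \<in> Poly_Mapping.keys f" for e
    proof -
      obtain ds where ds: "set ds \<subseteq> Poly_Mapping.keys e" "Poly_Mapping.single e 1 = (var_product ds :: 'k dpoly)"
        using single_eq_var_product[of "Poly_Mapping.keys e" "Poly_Mapping.lookup e"]
        unfolding sum_singles by auto
      have D: "set ds \<subseteq> Dset n m q" using ds(1) e f(1) by (auto simp: vars_def PD_simps(1))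
      have "?t e = Const (Poly_Mapping.lookup f e) * var_product ds"
        unfolding ds(2)[symmetric] by (simp add: Const_def mult_single)
      then show ?thesis
        using C_closed(7)[OF D] cls_var_product_in_span[OF D] C_closed(2)[OF C_closed(4) C_closed(7)[OF D]]
        by (simp add: cls_smult Sp_closed(2))
    qed
    have "(\<Sum>e\<in>E. ?t e) \<in> C \<and> cls (\<Sum>e\<in>E. ?t e) \<in> Sp" if "finite E" "E \<subseteq> Poly_Mapping.keys f" for E
      using that
    proof (induction E)
      case empty
      show ?case using C_closed(6) Sp_closed(3) by simp
    next
      case (insert e E)
      then show ?case
        using mono[of e] by (simp add: cls_add C_closed(1) Sp_closed(1))
    qed
    from this[of "Poly_Mapping.keys f"] show "x \<in> Sp"
      unfolding f(2) sum_singles by simp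
  qed
qed

end

theorem theorem4p4p3:
  fixes n m q :: nat and S :: "'k::alg_closed_field straightening"
  assumes "0 < n" and "n < m" and "n < q"
    and "straightening_relations n m q S"
  shows "vectorspace class_ring (RD n m q S) \<and>
         inj_on (D_class n m q S) (std_monomials n m q) \<and>
         vectorspace.basis class_ring (RD n m q S) (D_class n m q S ` std_monomials n m q)"
proof -
  interpret straightening_algebra n m q S
    using assms(1,4) by unfold_locales
  have "inj_on cls (std_monomials n m q)"
    using inj_on_cls_std unfolding std_monomials_eq by (auto simp: inj_on_def)
  then show ?thesis
    using vectorspace_R std_lin_indpt std_spans std_subset by (simp add: V.basis_def)
qed

end
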